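(* Let $(A,\mathfrak m)$ be a Noetherian local ring with infinite residue field, let $I$ be a regular ideal of $A$ with analytic spread one and reduction number $r$, and let $J=(a)$ be a minimal reduction of $I$. Let $\alpha_i$ ($0\le i\le r$) be the exponents of the free part in the graded decomposition of $F(I)$ as an $F(J)$-module $$F(I)\cong\bigoplus_{i=0}^r(F(J)(-i))^{\alpha_i}\oplus\bigoplus_{i=1}^{r-1}\bigoplus_{j=1}^{r-i}\left((F(J)/a^{j}F(J))(-i)\right)^{\alpha_{i,j}}.$$ Then for $1\leq i\leq r$, $$\alpha_i=\mu(I^i)-\mu(I^{i-1})-(f_{i,r-i}-f_{i-1,r-(i-1)}),$$ where $f_{k,l}:=\lambda\big((I^k\cap(\mathfrak m I^{k+l}:a^l))/\mathfrak m I^k\big)$.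
   Context: For an ideal $L$ of $A$, $F(L)=\bigoplus_{n\ge0}L^n/\mathfrak m L^n$ (with $L^0=A$) is its fiber cone; the analytic spread of $I$ is $l(I)=\dim F(I)$. An ideal is regular if it contains a non-zero-divisor of $A$. A reduction of $I$ is an ideal $J\subseteq I$ with $I^{n+1}=JI^n$ for some $n$; it is minimal if it is minimal under inclusion among reductions. When $l(I)=1$ (and the residue field is infinite) the minimal reductions of $I$ are principal; for $I$ regular of analytic spread one, the least $r$ with $I^{r+1}=JI^r$ does not depend on the minimal reduction $J$ and is called the reduction number $r$ of $I$. For a minimal reduction $J=(a)$, $F(J)\subseteq F(I)$ is a polynomial ring over $A/\mathfrak m$ in the one variable $a^0$ = class of $a$ in $I/\mathfrak m I$, and $F(I)$ is a finitely generated graded $F(J)$-module; $a^jF(J)$ means $(a^0)^jF(J)$, and $M(-i)_n=M_{n-i}$. A decomposition of the displayed form always exists, with exponents uniquely determined by $J$. $\lambda$ denotes length; colons are taken in $A$; $f_{k,l}=0$ if $k\notin\{1,\dots,r-1\}$. $\mu$ is the minimal number of generators, with $\mu(I^0)=1$. *)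

theory Defs
  imports "HOL-Algebra.Ring_Divisibility" "HOL-Algebra.Ideal_Product" "HOL-Algebra.Module"
    "HOL-Library.Extended_Nat"
begin

section \<open>Ideals of a local ring\<close>

locale noetherian_local_ring = cring R + noetherian_ring R for R (structure) +
  fixes \<mm> :: "'a set"
  assumes maximal: "maximalideal \<mm> R"
    and unique_maximal: "maximalideal M R \<Longrightarrow> M = \<mm>"

text \<open>Powers are taken in the multiplicative monoid of ideals, so \<open>L\<close> to the power \<open>0\<close>
  is the whole ring.\<close>

abbreviation ideal_pow :: "('a, 'b) ring_scheme \<Rightarrow> 'a set \<Rightarrow> nat \<Rightarrow> 'a set" where
  "ideal_pow R L n \<equiv> L [^]\<^bsub>ideals_set R\<^esub> n"

definition regular_ideal :: "('a, 'b) ring_scheme \<Rightarrow> 'a set \<Rightarrow> bool" where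
  "regular_ideal R L \<longleftrightarrow> ideal L R \<and>
     (\<exists>x\<in>L. \<forall>y\<in>carrier R. x \<otimes>\<^bsub>R\<^esub> y = \<zero>\<^bsub>R\<^esub> \<longrightarrow> y = \<zero>\<^bsub>R\<^esub>)"

definition colon :: "('a, 'b) ring_scheme \<Rightarrow> 'a set \<Rightarrow> 'a \<Rightarrow> 'a set" where
  "colon R L x = {y \<in> carrier R. y \<otimes>\<^bsub>R\<^esub> x \<in> L}"

definition min_num_gens :: "('a, 'b) ring_scheme \<Rightarrow> 'a set \<Rightarrow> nat" where
  "min_num_gens R L = (LEAST n. \<exists>S\<subseteq>carrier R. finite S \<and> card S = n \<and> Idl\<^bsub>R\<^esub> S = L)"

definition reduction :: "('a, 'b) ring_scheme \<Rightarrow> 'a set \<Rightarrow> 'a set \<Rightarrow> bool" where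
  "reduction R J I \<longleftrightarrow> ideal J R \<and> J \<subseteq> I \<and>
     (\<exists>n. ideal_pow R I (Suc n) = J \<cdot>\<^bsub>R\<^esub> ideal_pow R I n)"

definition minimal_reduction :: "('a, 'b) ring_scheme \<Rightarrow> 'a set \<Rightarrow> 'a set \<Rightarrow> bool" where
  "minimal_reduction R J I \<longleftrightarrow>
     reduction R J I \<and> (\<forall>K. reduction R K I \<and> K \<subseteq> J \<longrightarrow> K = J)"

text \<open>The common value, over all minimal reductions \<open>J\<close> of \<open>I\<close>, of the least \<open>n\<close> with
  \<open>I\<^sup>n\<^sup>+\<^sup>1 = J I\<^sup>n\<close>; only meaningful when this least \<open>n\<close> does not depend on \<open>J\<close>.\<close>

definition reduction_number :: "('a, 'b) ring_scheme \<Rightarrow> 'a set \<Rightarrow> nat" where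
  "reduction_number R I =
     (THE r. \<forall>J. minimal_reduction R J I \<longrightarrow>
        r = (LEAST n. ideal_pow R I (Suc n) = J \<cdot>\<^bsub>R\<^esub> ideal_pow R I n))"


section \<open>Krull dimension, length, subquotients\<close>

text \<open>The zero ring gets dimension \<open>0\<close> here.\<close>

definition krull_dim :: "('a, 'b) ring_scheme \<Rightarrow> enat" where
  "krull_dim R = (SUP n \<in> {n. \<exists>P :: nat \<Rightarrow> 'a set.
     (\<forall>i\<le>n. primeideal (P i) R) \<and> (\<forall>i<n. P i \<subset> P (Suc i))}. enat n)"

definition module_length :: "('r, 'c) ring_scheme \<Rightarrow> ('r, 'x, 'd) module_scheme \<Rightarrow> enat" where
  "module_length R M = (SUP n \<in> {n. \<exists>N :: nat \<Rightarrow> 'x set.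
     (\<forall>i\<le>n. submodule (N i) R M) \<and> (\<forall>i<n. N i \<subset> N (Suc i))}. enat n)"

text \<open>The \<open>R\<close>-module \<open>N/K\<close> for ideals \<open>K \<subseteq> N\<close> of \<open>R\<close>, with cosets as in \<open>R Quot K\<close>.
  The fields \<open>mult\<close> and \<open>one\<close>, irrelevant for the module structure, are those of \<open>R Quot K\<close>.\<close>

definition subquotient :: "('a, 'b) ring_scheme \<Rightarrow> 'a set \<Rightarrow> 'a set \<Rightarrow> ('a, 'a set) module" where
  "subquotient R N K =
     \<lparr>carrier = (\<lambda>x. K +>\<^bsub>R\<^esub> x) ` N, monoid.mult = rcoset_mult R K, one = K +>\<^bsub>R\<^esub> \<one>\<^bsub>R\<^esub>,
      zero = K, add = set_add R,
      smult = (\<lambda>r C. \<Union>x\<in>C. K +>\<^bsub>R\<^esub> (r \<otimes>\<^bsub>R\<^esub> x))\<rparr>"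


section \<open>The fiber cone\<close>

text \<open>An element is a family \<open>x\<close> with \<open>x n\<close> in \<open>L\<^sup>n / \<mm> L\<^sup>n\<close>, almost all zero. The product of
  classes in degrees \<open>k\<close> and \<open>n - k\<close> is the class modulo \<open>\<mm> L\<^sup>n\<close> of the product of
  representatives.\<close>

abbreviation fiber_piece ::
    "('a, 'b) ring_scheme \<Rightarrow> 'a set \<Rightarrow> 'a set \<Rightarrow> nat \<Rightarrow> ('a, 'a set) module" where
  "fiber_piece R \<mm> L n \<equiv> subquotient R (ideal_pow R L n) (\<mm> \<cdot>\<^bsub>R\<^esub> ideal_pow R L n)"

definition fiber_class ::
    "('a, 'b) ring_scheme \<Rightarrow> 'a set \<Rightarrow> 'a set \<Rightarrow> nat \<Rightarrow> 'a \<Rightarrow> (nat \<Rightarrow> 'a set)" where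
  "fiber_class R \<mm> L n u =
     (\<lambda>k. if k = n then (\<mm> \<cdot>\<^bsub>R\<^esub> ideal_pow R L n) +>\<^bsub>R\<^esub> u else \<zero>\<^bsub>fiber_piece R \<mm> L k\<^esub>)"

definition fiber_cone ::
    "('a, 'b) ring_scheme \<Rightarrow> 'a set \<Rightarrow> 'a set \<Rightarrow> (nat \<Rightarrow> 'a set) ring" where
  "fiber_cone R \<mm> L =
     \<lparr>carrier = {x. (\<forall>n. x n \<in> carrier (fiber_piece R \<mm> L n)) \<and>
                    finite {n. x n \<noteq> \<zero>\<^bsub>fiber_piece R \<mm> L n\<^esub>}},
      monoid.mult = (\<lambda>x y n. \<Oplus>\<^bsub>fiber_piece R \<mm> L n\<^esub>k\<in>{..n}.
                rcoset_mult R (\<mm> \<cdot>\<^bsub>R\<^esub> ideal_pow R L n) (x k) (y (n - k))),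
      one = fiber_class R \<mm> L 0 \<one>\<^bsub>R\<^esub>,
      zero = (\<lambda>n. \<zero>\<^bsub>fiber_piece R \<mm> L n\<^esub>),
      add = (\<lambda>x y n. x n \<oplus>\<^bsub>fiber_piece R \<mm> L n\<^esub> y n)\<rparr>"

definition fiber_degree ::
    "('a, 'b) ring_scheme \<Rightarrow> 'a set \<Rightarrow> 'a set \<Rightarrow> nat \<Rightarrow> (nat \<Rightarrow> 'a set) set" where
  "fiber_degree R \<mm> L n =
     {x \<in> carrier (fiber_cone R \<mm> L). \<forall>k. k \<noteq> n \<longrightarrow> x k = \<zero>\<^bsub>fiber_piece R \<mm> L k\<^esub>}"

definition analytic_spread :: "('a, 'b) ring_scheme \<Rightarrow> 'a set \<Rightarrow> 'a set \<Rightarrow> enat" where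
  "analytic_spread R \<mm> L = krull_dim (fiber_cone R \<mm> L)"


section \<open>Graded modules\<close>

text \<open>Modules graded by the natural numbers: \<open>homog M n\<close> is the component of degree \<open>n\<close>.
  The fields \<open>mult\<close> and \<open>one\<close> inherited from the library's module record are never used.\<close>

record ('r, 'x) gmodule = "('r, 'x) module" +
  homog :: "nat \<Rightarrow> 'x set"

definition gshift :: "nat \<Rightarrow> ('r, 'x) gmodule \<Rightarrow> ('r, 'x) gmodule" where
  "gshift i M = M\<lparr>homog := (\<lambda>n. if n < i then {\<zero>\<^bsub>M\<^esub>} else homog M (n - i))\<rparr>"

text \<open>Direct sum over a finite index set \<open>K\<close> (for infinite \<open>K\<close> this is the product).\<close>

definition gdirect_sum ::
    "'k set \<Rightarrow> ('k \<Rightarrow> ('r, 'x) gmodule) \<Rightarrow> ('r, 'k \<Rightarrow> 'x) gmodule" where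
  "gdirect_sum K M =
     \<lparr>carrier = (\<Pi>\<^sub>E k\<in>K. carrier (M k)), monoid.mult = undefined, one = undefined,
      zero = (\<lambda>k\<in>K. \<zero>\<^bsub>M k\<^esub>),
      add = (\<lambda>x y. \<lambda>k\<in>K. x k \<oplus>\<^bsub>M k\<^esub> y k),
      smult = (\<lambda>r x. \<lambda>k\<in>K. r \<odot>\<^bsub>M k\<^esub> x k),
      homog = (\<lambda>n. \<Pi>\<^sub>E k\<in>K. homog (M k) n)\<rparr>"

definition gcopies :: "('r, 'x) gmodule \<Rightarrow> nat \<Rightarrow> ('r, nat \<Rightarrow> 'x) gmodule" where
  "gcopies M c = gdirect_sum {..<c} (\<lambda>_. M)"

definition gdirect_sum2 ::
    "('r, 'x) gmodule \<Rightarrow> ('r, 'y) gmodule \<Rightarrow> ('r, 'x \<times> 'y) gmodule" where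
  "gdirect_sum2 M N =
     \<lparr>carrier = carrier M \<times> carrier N, monoid.mult = undefined, one = undefined,
      zero = (\<zero>\<^bsub>M\<^esub>, \<zero>\<^bsub>N\<^esub>),
      add = (\<lambda>x y. (fst x \<oplus>\<^bsub>M\<^esub> fst y, snd x \<oplus>\<^bsub>N\<^esub> snd y)),
      smult = (\<lambda>r x. (r \<odot>\<^bsub>M\<^esub> fst x, r \<odot>\<^bsub>N\<^esub> snd x)),
      homog = (\<lambda>n. homog M n \<times> homog N n)\<rparr>"

definition gmodule_iso ::
    "('r, 'c) ring_scheme \<Rightarrow> ('r, 'x) gmodule \<Rightarrow> ('r, 'y) gmodule \<Rightarrow> bool" where
  "gmodule_iso R M N \<longleftrightarrow>
     (\<exists>\<phi>. bij_betw \<phi> (carrier M) (carrier N) \<and>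
        (\<forall>x\<in>carrier M. \<forall>y\<in>carrier M. \<phi> (x \<oplus>\<^bsub>M\<^esub> y) = \<phi> x \<oplus>\<^bsub>N\<^esub> \<phi> y) \<and>
        (\<forall>r\<in>carrier R. \<forall>x\<in>carrier M. \<phi> (r \<odot>\<^bsub>M\<^esub> x) = r \<odot>\<^bsub>N\<^esub> \<phi> x) \<and>
        (\<forall>n. \<phi> ` homog M n = homog N n))"


section \<open>Fiber cones as graded modules\<close>

text \<open>The map \<open>F(J) \<rightarrow> F(I)\<close> induced by \<open>J \<subseteq> I\<close>: the coset \<open>\<mm> J\<^sup>n + u\<close> goes to \<open>\<mm> I\<^sup>n + u\<close>.\<close>

definition fiber_incl ::
    "('a, 'b) ring_scheme \<Rightarrow> 'a set \<Rightarrow> 'a set \<Rightarrow> (nat \<Rightarrow> 'a set) \<Rightarrow> (nat \<Rightarrow> 'a set)" where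
  "fiber_incl R \<mm> I x = (\<lambda>n. (\<mm> \<cdot>\<^bsub>R\<^esub> ideal_pow R I n) <+>\<^bsub>R\<^esub> x n)"

text \<open>\<open>F(I)\<close> as a graded module over \<open>F(J)\<close> for any ideal \<open>J \<subseteq> I\<close>; for \<open>I = J\<close> this is \<open>F(J)\<close>
  as a graded module over itself.\<close>

definition fiber_gmodule ::
    "('a, 'b) ring_scheme \<Rightarrow> 'a set \<Rightarrow> 'a set \<Rightarrow> (nat \<Rightarrow> 'a set, nat \<Rightarrow> 'a set) gmodule" where
  "fiber_gmodule R \<mm> I =
     (let F = fiber_cone R \<mm> I in
      \<lparr>carrier = carrier F, monoid.mult = monoid.mult F, one = \<one>\<^bsub>F\<^esub>, zero = \<zero>\<^bsub>F\<^esub>, add = add F,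
       smult = (\<lambda>s x. fiber_incl R \<mm> I s \<otimes>\<^bsub>F\<^esub> x),
       homog = fiber_degree R \<mm> I\<rparr>)"

definition fiber_quotient ::
    "('a, 'b) ring_scheme \<Rightarrow> 'a set \<Rightarrow> 'a set \<Rightarrow> (nat \<Rightarrow> 'a set) set \<Rightarrow>
     (nat \<Rightarrow> 'a set, (nat \<Rightarrow> 'a set) set) gmodule" where
  "fiber_quotient R \<mm> J K =
     (let F = fiber_cone R \<mm> J; Q = subquotient F (carrier F) K in
      \<lparr>carrier = carrier Q, monoid.mult = monoid.mult Q, one = \<one>\<^bsub>Q\<^esub>, zero = \<zero>\<^bsub>Q\<^esub>, add = add Q,
       smult = smult Q,
       homog = (\<lambda>n. (\<lambda>x. K +>\<^bsub>F\<^esub> x) ` fiber_degree R \<mm> J n)\<rparr>)"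

text \<open>The ideal \<open>a\<^sup>j F(J)\<close> for \<open>J = (a)\<close>, where \<open>a\<close> stands for its class in degree one.\<close>

definition fiber_power_ideal ::
    "('a, 'b) ring_scheme \<Rightarrow> 'a set \<Rightarrow> 'a \<Rightarrow> nat \<Rightarrow> (nat \<Rightarrow> 'a set) set" where
  "fiber_power_ideal R \<mm> a j =
     (let J = PIdl\<^bsub>R\<^esub> a; F = fiber_cone R \<mm> J in
      PIdl\<^bsub>F\<^esub> (fiber_class R \<mm> J 1 a [^]\<^bsub>F\<^esub> j))"

text \<open>The graded \<open>F(J)\<close>-module, for \<open>J = (a)\<close>, with free exponents \<open>\<alpha>\<close> and torsion exponents
  \<open>\<beta>\<close>:
  \<open>\<Oplus>\<^bsub>0\<le>i\<le>r\<^esub> F(J)(-i)\<^bsup>\<alpha> i\<^esup> \<oplus> \<Oplus>\<^bsub>1\<le>i\<le>r-1\<^esub> \<Oplus>\<^bsub>1\<le>j\<le>r-i\<^esub> (F(J)/a\<^sup>j F(J))(-i)\<^bsup>\<beta> i j\<^esup>\<close>.\<close>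

definition fiber_decomposition_module ::
    "('a, 'b) ring_scheme \<Rightarrow> 'a set \<Rightarrow> 'a \<Rightarrow> nat \<Rightarrow> (nat \<Rightarrow> nat) \<Rightarrow> (nat \<Rightarrow> nat \<Rightarrow> nat) \<Rightarrow>
     (nat \<Rightarrow> 'a set,
      (nat \<Rightarrow> nat \<Rightarrow> nat \<Rightarrow> 'a set) \<times> (nat \<times> nat \<Rightarrow> nat \<Rightarrow> (nat \<Rightarrow> 'a set) set)) gmodule" where
  "fiber_decomposition_module R \<mm> a r \<alpha> \<beta> =
     gdirect_sum2
       (gdirect_sum {0..r}
          (\<lambda>i. gcopies (gshift i (fiber_gmodule R \<mm> (PIdl\<^bsub>R\<^esub> a))) (\<alpha> i)))
       (gdirect_sum (SIGMA i:{1..r-1}. {1..r-i})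
          (\<lambda>(i, j). gcopies (gshift i (fiber_quotient R \<mm> (PIdl\<^bsub>R\<^esub> a)
                                         (fiber_power_ideal R \<mm> a j))) (\<beta> i j)))"

text \<open>The invariant \<open>f\<^sub>k\<^sub>,\<^sub>l\<close>, set to \<open>0\<close> outside \<open>1 \<le> k \<le> r - 1\<close>. The module is a subspace of
  \<open>I\<^sup>k / \<mm> I\<^sup>k\<close>, so over a Noetherian local ring its length is finite and \<^const>\<open>the_enat\<close> loses
  nothing.\<close>

definition f_length ::
    "('a, 'b) ring_scheme \<Rightarrow> 'a set \<Rightarrow> 'a set \<Rightarrow> 'a \<Rightarrow> nat \<Rightarrow> nat \<Rightarrow> nat \<Rightarrow> nat" where
  "f_length R \<mm> I a r k l =
     (if k \<in> {1..r-1}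
      then the_enat (module_length R (subquotient R
             (ideal_pow R I k \<inter> colon R (\<mm> \<cdot>\<^bsub>R\<^esub> ideal_pow R I (k + l)) (a [^]\<^bsub>R\<^esub> l))
             (\<mm> \<cdot>\<^bsub>R\<^esub> ideal_pow R I k)))
      else 0)"

end

theory Submission
  imports Defs
begin

text \<open>Multiplication by \<open>a\<^sup>r\<^sup>-\<^sup>i\<close> on the degree \<open>i\<close> component of the decomposition is injective on the
  free part, whose dimension is \<open>\<alpha>\<^sub>0 + \<dots> + \<alpha>\<^sub>i\<close>, and kills the torsion part, since a summand
  \<open>(F(J)/a\<^sup>jF(J))(-k)\<close> has \<open>k + j \<le> r\<close>. Hence \<open>f\<^sub>i\<^sub>,\<^sub>r\<^sub>-\<^sub>i\<close> is the dimension of the torsion part, which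
  vanishes for \<open>i = 0\<close> and \<open>i = r\<close>, and \<open>\<mu>(I\<^sup>i) = \<alpha>\<^sub>0 + \<dots> + \<alpha>\<^sub>i + f\<^sub>i\<^sub>,\<^sub>r\<^sub>-\<^sub>i\<close>. Both \<open>\<mu>\<close> and the length are
  computed from a basis of coordinate functions: such a basis gives a chain of ideals with simple
  steps. Each degree of \<open>F(J)\<close> is one-dimensional because \<open>a\<close> is not nilpotent, \<open>I\<close> being regular.\<close>

section \<open>Local rings\<close>

text \<open>The exponent \<open>r - i\<close> is the one that carries degree \<open>i\<close> into
  degree \<open>r\<close>, a degree that no torsion summand reaches. The identity for
  \<open>\<mu>\<close> holds in every degree from 0 to \<open>r\<close>, and its instances at
  \<open>i\<close> and \<open>i - 1\<close> differ by \<open>\<alpha> i\<close> and the two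
  correction terms. The obstacle is that neither invariant is by definition a dimension:
  \<open>\<mu>\<close> is a least number of generators of an ideal of the ring, and length is a
  supremum over chains of submodules. Vector spaces over the residue field are therefore not formed.
  A coordinate enters only through its kernel, which pulls back to an ideal of the ring. Both
  invariants are then squeezed in the same way: a dual basis yields a chain with one step per basis
  element, while each generator killed by \<open>\<mm>\<close> modulo the bottom ideal contributes
  at most one step to any chain. Nakayama's lemma turns generators modulo \<open>\<mm> I^i\<close>
  into generators of \<open>I^i\<close>.\<close>

lemma (in cring) idealI_add_mult:
  assumes "N \<subseteq> carrier R" "\<zero> \<in> N"
    and add: "\<And>x y. x \<in> N \<Longrightarrow> y \<in> N \<Longrightarrow> x \<oplus> y \<in> N"
    and mult: "\<And>c x. c \<in> carrier R \<Longrightarrow> x \<in> N \<Longrightarrow> c \<otimes> x \<in> N"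
  shows "ideal N R"
proof (rule idealI[OF ring_axioms])
  show "subgroup N (add_monoid R)"
  proof (rule add.subgroupI)
    fix x assume x: "x \<in> N"
    then have xc: "x \<in> carrier R"
      using assms by auto
    have "(\<ominus> \<one>) \<otimes> x \<in> N"
      using x mult by simp
    also have "(\<ominus> \<one>) \<otimes> x = \<ominus> x"
      using xc by (simp add: l_minus)
    finally show "\<ominus> x \<in> N" .
  qed (use assms in auto)
next
  fix x c assume "x \<in> N" "c \<in> carrier R"
  then show "c \<otimes> x \<in> N" "x \<otimes> c \<in> N"
    using mult[of c x] assms(1) by (auto simp: m_comm)
qed

lemma (in cring) ideal_closed:
  assumes "ideal N R"
  shows "\<zero> \<in> N" "N \<subseteq> carrier R"
    and "\<And>x y. x \<in> N \<Longrightarrow> y \<in> N \<Longrightarrow> x \<oplus> y \<in> N"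
    and "\<And>x y. x \<in> N \<Longrightarrow> y \<in> N \<Longrightarrow> x \<ominus> y \<in> N"
    and "\<And>c x. c \<in> carrier R \<Longrightarrow> x \<in> N \<Longrightarrow> c \<otimes> x \<in> N"
proof -
  interpret N: ideal N R
    by fact
  show "\<zero> \<in> N" "N \<subseteq> carrier R"
    using N.a_subset by auto
  show "\<And>x y. x \<in> N \<Longrightarrow> y \<in> N \<Longrightarrow> x \<oplus> y \<in> N" "\<And>x y. x \<in> N \<Longrightarrow> y \<in> N \<Longrightarrow> x \<ominus> y \<in> N"
    by (auto simp: a_minus_def)
  show "\<And>c x. c \<in> carrier R \<Longrightarrow> x \<in> N \<Longrightarrow> c \<otimes> x \<in> N"
    by (rule N.I_l_closed)
qed

text \<open>This is the sum \<open>N + (x)\<close>, written as the elements congruent modulo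
  \<open>N\<close> to a multiple of \<open>x\<close>. In this form the coefficient of
  \<open>x\<close>, which the later arguments manipulate, is directly available.\<close>

lemma (in cring) ideal_add_principal:
  assumes "ideal N R" "x \<in> carrier R"
  shows "ideal {u \<in> carrier R. \<exists>c\<in>carrier R. u \<ominus> c \<otimes> x \<in> N} R" (is "ideal ?M R")
proof (rule idealI_add_mult)
  note N = ideal_closed[OF assms(1)]
  show "\<zero> \<in> ?M"
  proof -
    have "\<zero> \<ominus> \<zero> \<otimes> x = \<zero>"
      using assms(2) by (simp add: a_minus_def)
    then show ?thesis
      using N(1) zero_closed by force
  qed
  fix u assume "u \<in> ?M"
  then obtain c where c: "u \<in> carrier R" "c \<in> carrier R" "u \<ominus> c \<otimes> x \<in> N"
    by auto
  {
    fix v assume "v \<in> ?M"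
    then obtain d where d: "v \<in> carrier R" "d \<in> carrier R" "v \<ominus> d \<otimes> x \<in> N"
      by auto
    have "(u \<oplus> v) \<ominus> (c \<oplus> d) \<otimes> x = (u \<ominus> c \<otimes> x) \<oplus> (v \<ominus> d \<otimes> x)"
      using c(1,2) d(1,2) assms(2) by algebra
    then have "(u \<oplus> v) \<ominus> (c \<oplus> d) \<otimes> x \<in> N"
      using N(3)[OF c(3) d(3)] by simp
    then show "u \<oplus> v \<in> ?M"
      using c(1,2) d(1,2) by (intro CollectI conjI bexI[of _ "c \<oplus> d"]) auto
  }
  fix d assume d: "d \<in> carrier R"
  have "d \<otimes> u \<ominus> (d \<otimes> c) \<otimes> x = d \<otimes> (u \<ominus> c \<otimes> x)"
    using c(1,2) d assms(2) by algebra
  then have "d \<otimes> u \<ominus> (d \<otimes> c) \<otimes> x \<in> N"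
    using N(5)[OF d c(3)] by simp
  then show "d \<otimes> u \<in> ?M"
    using c(1,2) d by (intro CollectI conjI bexI[of _ "d \<otimes> c"]) auto
qed auto

lemma (in cring) genideal_insertD:
  assumes "ideal N R" "S \<subseteq> N" "x \<in> carrier R" "u \<in> Idl (insert x S)"
  shows "\<exists>c\<in>carrier R. u \<ominus> c \<otimes> x \<in> N"
proof -
  note N = ideal_closed[OF assms(1)]
  have "insert x S \<subseteq> {u \<in> carrier R. \<exists>c\<in>carrier R. u \<ominus> c \<otimes> x \<in> N}"
  proof -
    have "x \<ominus> \<one> \<otimes> x = \<zero>"
      using assms(3) by (simp add: r_neg a_minus_def)
    then have "\<exists>c\<in>carrier R. x \<ominus> c \<otimes> x \<in> N"
      using N(1) one_closed by metis
    moreover have "\<exists>c\<in>carrier R. s \<ominus> c \<otimes> x \<in> N" if "s \<in> S" for s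
    proof -
      have "s \<ominus> \<zero> \<otimes> x = s"
        using that assms(2,3) N(2) by (auto simp: a_minus_def)
      then show ?thesis
        using that assms(2) zero_closed by (metis subsetD)
    qed
    ultimately show ?thesis
      using assms(2,3) N(2) by auto
  qed
  from genideal_minimal[OF ideal_add_principal[OF assms(1,3)] this] show ?thesis
    using assms(4) by auto
qed

text \<open>Zorn's lemma on the ideals above \<open>B\<close> that are properly contained in
  \<open>N\<close>. In a Noetherian ring a nonempty chain of ideals contains its own union, so the
  upper bound is still different from \<open>N\<close>. With \<open>N\<close> the whole ring this
  yields maximal ideals; with \<open>N\<close> an ideal it drives Nakayama's lemma.\<close>

lemma (in noetherian_ring) maximal_proper_subideal:
  assumes "ideal B R" "B \<subset> N"
  obtains M where "ideal M R" "B \<subseteq> M" "M \<subset> N"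
    "\<And>M'. ideal M' R \<Longrightarrow> M \<subseteq> M' \<Longrightarrow> M' \<subset> N \<Longrightarrow> M' = M"
proof -
  let ?A = "{M. ideal M R \<and> B \<subseteq> M \<and> M \<subset> N}"
  have "\<exists>U\<in>?A. \<forall>X\<in>C. X \<subseteq> U" if C: "subset.chain ?A C" for C
  proof (cases "C = {}")
    case True
    then show ?thesis
      using assms by auto
  next
    case False
    have "subset.chain {I. ideal I R} C" "C \<subseteq> ?A"
      using C unfolding pred_on.chain_def by auto
    then have "\<Union>C \<in> ?A"
      using ideal_chain_is_trivial[OF False] by blast
    then show ?thesis
      by blast
  qed
  from subset_Zorn[of ?A, OF this] obtain M where M: "M \<in> ?A" "\<forall>X\<in>?A. M \<subseteq> X \<longrightarrow> X = M"
    by auto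
  show ?thesis
  proof (rule that)
    fix M' assume "ideal M' R" "M \<subseteq> M'" "M' \<subset> N"
    with M show "M' = M"
      by auto
  qed (use M in auto)
qed

context noetherian_local_ring
begin

lemma \<mm>_ideal: "ideal \<mm> R"
  using maximal by (rule maximalideal.axioms)

lemma one_notin_\<mm>: "\<one> \<notin> \<mm>"
  using ideal.one_imp_carrier[OF \<mm>_ideal] maximalideal.I_notcarr[OF maximal] by auto

text \<open>Otherwise \<open>(c)\<close> would be proper and lie in a maximal ideal, and the only
  one is \<open>\<mm>\<close>.\<close>

lemma unit_outside_\<mm>:
  assumes "c \<in> carrier R" "c \<notin> \<mm>"
  obtains d where "d \<in> carrier R" "d \<otimes> c = \<one>"
proof -
  have "\<one> \<in> PIdl c"
  proof (rule ccontr)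
    assume "\<one> \<notin> PIdl c"
    then have "PIdl c \<subset> carrier R"
      using ideal_closed(2)[OF cgenideal_ideal[OF assms(1)]] one_closed by blast
    then obtain M where M: "ideal M R" "PIdl c \<subseteq> M" "M \<subset> carrier R"
      "\<And>M'. ideal M' R \<Longrightarrow> M \<subseteq> M' \<Longrightarrow> M' \<subset> carrier R \<Longrightarrow> M' = M"
      using maximal_proper_subideal[OF cgenideal_ideal[OF assms(1)]] by metis
    have "maximalideal M R"
      using M by (intro maximalidealI) auto
    then show False
      using unique_maximal M(2) assms cgenideal_self by blast
  qed
  then show ?thesis
    using that unfolding cgenideal_def by auto
qed

text \<open>If \<open>N \<noteq> B\<close>, pick \<open>M \<supseteq> B\<close> maximal among the proper subideals of \<open>N\<close>;
  then \<open>N = M + (x)\<close> and \<open>N = M + \<mm>N\<close> forces \<open>(1 - c) x \<in> M\<close> for some \<open>c \<in> \<mm>\<close>.\<close>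

lemma nakayama:
  assumes N: "ideal N R" and B: "ideal B R" "B \<subseteq> N"
    and gen: "N \<subseteq> Idl (\<mm> \<cdot> N \<union> B)"
  shows "N = B"
proof (rule ccontr)
  assume "N \<noteq> B"
  with B have "B \<subset> N"
    by auto
  then obtain M where M: "ideal M R" "B \<subseteq> M" "M \<subset> N"
    "\<And>M'. ideal M' R \<Longrightarrow> M \<subseteq> M' \<Longrightarrow> M' \<subset> N \<Longrightarrow> M' = M"
    using maximal_proper_subideal[OF B(1)] by metis
  note Mc = ideal_closed[OF M(1)] and Nc = ideal_closed[OF N] and mc = ideal_closed[OF \<mm>_ideal]
  obtain x where x: "x \<in> N" "x \<notin> M"
    using M by auto
  then have xc: "x \<in> carrier R"
    using Nc by auto
  let ?M' = "Idl (insert x M)"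
  have sub: "insert x M \<subseteq> carrier R"
    using xc Mc by auto
  have "?M' = N"
    using M(4)[of ?M'] genideal_ideal[OF sub] genideal_self[OF sub] x
      genideal_minimal[OF N, of "insert x M"] M(3) by blast
  then have rep: "\<exists>c\<in>carrier R. u \<ominus> c \<otimes> x \<in> M" if "u \<in> N" for u
    using genideal_insertD[OF M(1) subset_refl xc] that by auto
  \<comment> \<open>\<open>?K\<close> is \<open>M + \<mm> x\<close>. Since every element of
    \<open>N\<close> is a multiple of \<open>x\<close> modulo \<open>M\<close>, it contains
    \<open>\<mm> N\<close>; it contains \<open>B\<close> as well, hence all of \<open>N\<close> and
    in particular \<open>x\<close>.\<close>
  let ?K = "{u \<in> carrier R. \<exists>c\<in>\<mm>. u \<ominus> c \<otimes> x \<in> M}"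
  have K: "ideal ?K R"
  proof (rule idealI_add_mult)
    have "\<zero> \<ominus> \<zero> \<otimes> x = \<zero>"
      using xc by (simp add: a_minus_def)
    then show "\<zero> \<in> ?K"
      using Mc(1) mc(1) by force
    fix u assume "u \<in> ?K"
    then obtain c where c: "u \<in> carrier R" "c \<in> \<mm>" "c \<in> carrier R" "u \<ominus> c \<otimes> x \<in> M"
      using mc by auto
    {
      fix v assume "v \<in> ?K"
      then obtain d where d: "v \<in> carrier R" "d \<in> \<mm>" "d \<in> carrier R" "v \<ominus> d \<otimes> x \<in> M"
        using mc by auto
      have "(u \<oplus> v) \<ominus> (c \<oplus> d) \<otimes> x = (u \<ominus> c \<otimes> x) \<oplus> (v \<ominus> d \<otimes> x)"
        using c(1,3) d(1,3) xc by algebra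
      then have "(u \<oplus> v) \<ominus> (c \<oplus> d) \<otimes> x \<in> M"
        using Mc(3)[OF c(4) d(4)] by simp
      then show "u \<oplus> v \<in> ?K"
        using c d mc by (intro CollectI conjI bexI[of _ "c \<oplus> d"]) auto
    }
    fix d assume d: "d \<in> carrier R"
    have "d \<otimes> u \<ominus> (d \<otimes> c) \<otimes> x = d \<otimes> (u \<ominus> c \<otimes> x)"
      using c(1,3) d xc by algebra
    then have "d \<otimes> u \<ominus> (d \<otimes> c) \<otimes> x \<in> M"
      using Mc(5)[OF d c(4)] by simp
    then show "d \<otimes> u \<in> ?K"
      using c d mc by (intro CollectI conjI bexI[of _ "d \<otimes> c"]) auto
  qed auto
  have "\<mm> \<cdot> N \<subseteq> ?K"
  proof
    fix s assume "s \<in> \<mm> \<cdot> N"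
    then show "s \<in> ?K"
    proof induct
      case (prod c u)
      then obtain d where d: "d \<in> carrier R" "u \<ominus> d \<otimes> x \<in> M"
        using rep by auto
      have cu: "c \<in> carrier R" "u \<in> carrier R"
        using prod mc Nc by auto
      have "c \<otimes> u \<ominus> (d \<otimes> c) \<otimes> x = c \<otimes> (u \<ominus> d \<otimes> x)"
        using cu d(1) xc by algebra
      then have "c \<otimes> u \<ominus> (d \<otimes> c) \<otimes> x \<in> M"
        using Mc(5)[OF cu(1) d(2)] by simp
      then show ?case
        using prod mc(5)[OF d(1) prod(1)] cu d by (intro CollectI conjI bexI[of _ "d \<otimes> c"]) auto
    qed (use ideal_closed(3)[OF K] in blast)
  qed
  moreover have "B \<subseteq> ?K"
  proof
    fix u assume "u \<in> B"
    then have u: "u \<in> M" "u \<in> carrier R"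
      using M Mc by auto
    have "u \<ominus> \<zero> \<otimes> x = u"
      using u xc by (simp add: a_minus_def)
    then show "u \<in> ?K"
      using u mc(1) by force
  qed
  ultimately have "x \<in> ?K"
    using gen genideal_minimal[OF K, of "\<mm> \<cdot> N \<union> B"] x by auto
  then obtain c where c: "c \<in> \<mm>" "c \<in> carrier R" "x \<ominus> c \<otimes> x \<in> M"
    using mc by auto
  \<comment> \<open>Hence \<open>\<one> \<ominus> c\<close> is a unit, and cancelling it in
    \<open>(\<one> \<ominus> c) \<otimes> x \<in> M\<close> puts \<open>x\<close> into
    \<open>M\<close>.\<close>
  have "\<one> \<ominus> c \<notin> \<mm>"
  proof
    assume "\<one> \<ominus> c \<in> \<mm>"
    from mc(3)[OF this c(1)] have "\<one> \<in> \<mm>"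
      using c(2) by (simp add: a_minus_def a_assoc l_neg)
    then show False
      using one_notin_\<mm> by simp
  qed
  then obtain d where d: "d \<in> carrier R" "d \<otimes> (\<one> \<ominus> c) = \<one>"
    using unit_outside_\<mm>[of "\<one> \<ominus> c"] c(2) by auto
  have "d \<otimes> (x \<ominus> c \<otimes> x) = (d \<otimes> (\<one> \<ominus> c)) \<otimes> x"
    using d(1) c(2) xc by algebra
  also have "\<dots> = x"
    using d xc by simp
  finally have "x \<in> M"
    using Mc(5)[OF d(1) c(3)] by simp
  with x show False
    by simp
qed

end

section \<open>Chains of ideals\<close>

text \<open>By the correspondence theorem these are the chains that define the length of
  \<open>N/K\<close>. Staying with ideals of the ring lets \<open>N\<close> vary in inductions
  without a change of quotient; the ends of the chain need not be \<open>K\<close> and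
  \<open>N\<close>.\<close>

definition ideal_chain :: "('a, 'b) ring_scheme \<Rightarrow> 'a set \<Rightarrow> 'a set \<Rightarrow> nat \<Rightarrow> bool" where
  "ideal_chain R K N n \<longleftrightarrow>
     (\<exists>M. (\<forall>i\<le>n. ideal (M i) R \<and> K \<subseteq> M i \<and> M i \<subseteq> N) \<and> (\<forall>i<n. M i \<subset> M (Suc i)))"

lemma ideal_chain_extend:
  assumes "ideal_chain R K N n" "ideal N' R" "N \<subset> N'"
  shows "ideal_chain R K N' (Suc n)"
proof -
  obtain M where M: "\<And>i. i \<le> n \<Longrightarrow> ideal (M i) R \<and> K \<subseteq> M i \<and> M i \<subseteq> N"
    "\<And>i. i < n \<Longrightarrow> M i \<subset> M (Suc i)"
    using assms(1) unfolding ideal_chain_def by auto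
  let ?M = "\<lambda>i. if i \<le> n then M i else N'"
  have "ideal (?M i) R \<and> K \<subseteq> ?M i \<and> ?M i \<subseteq> N'" for i
    using M(1)[of i] M(1)[of 0] assms(2,3) by auto
  moreover have "?M i \<subset> ?M (Suc i)" if "i < Suc n" for i
    using that M(1)[of i] M(2)[of i] assms(3) by (cases "i = n") auto
  ultimately show ?thesis
    unfolding ideal_chain_def by (intro exI[of _ ?M]) simp
qed

context noetherian_local_ring
begin

text \<open>Modulo \<open>N\<close> the multiples of \<open>x\<close> form a residue field space of
  dimension at most one. So a multiple \<open>v\<close> of \<open>x\<close> outside \<open>N\<close>
  spans it: its coefficient \<open>d\<close> cannot lie in \<open>\<mm>\<close>, and the inverse of
  \<open>d\<close> rewrites \<open>x\<close> in terms of \<open>v\<close>.\<close>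

lemma simple_step_absorb:
  assumes "ideal N R" and x: "x \<in> carrier R" "\<And>c. c \<in> \<mm> \<Longrightarrow> c \<otimes> x \<in> N"
    and "ideal M R" "v \<in> M" "v \<notin> N" and v: "d \<in> carrier R" "v \<ominus> d \<otimes> x \<in> N"
    and u: "u \<in> carrier R" "c \<in> carrier R" "u \<ominus> c \<otimes> x \<in> N"
  shows "\<exists>e\<in>carrier R. u \<ominus> e \<otimes> v \<in> N"
proof -
  note Nc = ideal_closed[OF assms(1)]
  have vc: "v \<in> carrier R"
    using assms(4,5) ideal_closed(2) by blast
  have "d \<notin> \<mm>"
  proof
    assume "d \<in> \<mm>"
    then have "(v \<ominus> d \<otimes> x) \<oplus> d \<otimes> x \<in> N"
      using Nc(3) v(2) x(2) by blast
    moreover have "(v \<ominus> d \<otimes> x) \<oplus> d \<otimes> x = v"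
      using v(1) x(1) vc by algebra
    ultimately show False
      using assms(6) by simp
  qed
  then obtain g where g: "g \<in> carrier R" "g \<otimes> d = \<one>"
    using unit_outside_\<mm> v(1) by blast
  have "u \<ominus> (c \<otimes> g) \<otimes> v = (u \<ominus> c \<otimes> x) \<oplus> (c \<otimes> ((g \<otimes> d) \<otimes> x) \<ominus> (c \<otimes> g) \<otimes> v)"
    using u(1,2) x(1) g vc v(1) by (simp only: g(2)) algebra
  also have "c \<otimes> ((g \<otimes> d) \<otimes> x) \<ominus> (c \<otimes> g) \<otimes> v = \<zero> \<ominus> (c \<otimes> g) \<otimes> (v \<ominus> d \<otimes> x)"
    using u(1,2) x(1) g(1) vc v(1) by algebra
  finally have "u \<ominus> (c \<otimes> g) \<otimes> v \<in> N"
    using Nc(1) Nc(3)[OF u(3) Nc(4)[OF Nc(1) Nc(5)[OF _ v(2)]]] u(2) g(1) by simp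
  then show ?thesis
    using u(2) g(1) by blast
qed

text \<open>Adding an element that is simple modulo \<open>N\<close>: of the ideals of a chain, those contained in
  \<open>N\<close> are kept; the first other one is dropped and the later ones are intersected with \<open>N\<close>.\<close>

lemma ideal_chain_simple_step:
  assumes N: "ideal N R" and x: "x \<in> carrier R" "\<And>c. c \<in> \<mm> \<Longrightarrow> c \<otimes> x \<in> N"
    and N': "\<And>u. u \<in> N' \<Longrightarrow> \<exists>c\<in>carrier R. u \<ominus> c \<otimes> x \<in> N"
    and KN: "K \<subseteq> N"
    and bound: "\<And>n. ideal_chain R K N n \<Longrightarrow> n \<le> d"
    and chain: "ideal_chain R K N' n"
  shows "n \<le> Suc d"
proof -
  note Nc = ideal_closed[OF N]
  obtain M where M: "\<And>i. i \<le> n \<Longrightarrow> ideal (M i) R \<and> K \<subseteq> M i \<and> M i \<subseteq> N'"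
    "\<And>i. i < n \<Longrightarrow> M i \<subset> M (Suc i)"
    using chain unfolding ideal_chain_def by auto
  show ?thesis
  proof (cases "\<forall>i\<le>n. M i \<subseteq> N")
    case True
    then have "ideal_chain R K N n"
      unfolding ideal_chain_def using M by (intro exI[of _ M]) auto
    then show ?thesis
      using bound by force
  next
    case False
    define k where "k = (LEAST i. \<not> M i \<subseteq> N)"
    have k: "\<not> M k \<subseteq> N" "k \<le> n"
      using False LeastI_ex[of "\<lambda>i. \<not> M i \<subseteq> N"] Least_le[of "\<lambda>i. \<not> M i \<subseteq> N"]
      unfolding k_def by (auto intro: order_trans)
    have below: "M i \<subseteq> N" if "i < k" for i
      using not_less_Least[of i "\<lambda>i. \<not> M i \<subseteq> N"] that unfolding k_def by auto
    have mono: "M i \<subseteq> M j" if "i \<le> j" "j \<le> n" for i j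
      using that
    proof (induct rule: dec_induct)
      case (step m)
      then show ?case
        using M(2)[of m] by auto
    qed simp
    \<comment> \<open>From index \<open>k\<close> on, \<open>M i\<close> contains some
      \<open>v\<close> outside \<open>N\<close>. Subtracting a multiple of \<open>v\<close> moves a
      new element \<open>u\<close> of \<open>M (Suc i)\<close> into \<open>N\<close>, and it stays
      outside \<open>M i\<close> because \<open>v\<close> is inside.\<close>
    have strict: "M i \<inter> N \<subset> M (Suc i) \<inter> N" if i: "k \<le> i" "i < n" for i
    proof -
      obtain v where v: "v \<in> M i" "v \<notin> N"
        using k mono[of k i] i by auto
      obtain u where u: "u \<in> M (Suc i)" "u \<notin> M i"
        using M(2)[of i] i by auto
      have Mi: "ideal (M i) R" "M i \<subseteq> N'" "ideal (M (Suc i)) R" "M (Suc i) \<subseteq> N'"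
        using M(1)[of i] M(1)[of "Suc i"] i by auto
      note Mic = ideal_closed[OF Mi(1)] and Msc = ideal_closed[OF Mi(3)]
      have uc: "u \<in> carrier R" and vc: "v \<in> carrier R"
        using u v Msc Mic by auto
      obtain dv cu where "dv \<in> carrier R" "v \<ominus> dv \<otimes> x \<in> N" "cu \<in> carrier R" "u \<ominus> cu \<otimes> x \<in> N"
        using N'[of v] N'[of u] u v Mi by blast
      then obtain e where e: "e \<in> carrier R" "u \<ominus> e \<otimes> v \<in> N"
        using simple_step_absorb[OF N x Mi(1) v] uc by blast
      have "v \<in> M (Suc i)"
        using v M(2)[of i] i by auto
      then have "u \<ominus> e \<otimes> v \<in> M (Suc i)"
        using Msc(4)[OF u(1) Msc(5)[OF e(1)]] by simp
      moreover have "u \<ominus> e \<otimes> v \<notin> M i"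
      proof
        assume "u \<ominus> e \<otimes> v \<in> M i"
        then have "(u \<ominus> e \<otimes> v) \<oplus> e \<otimes> v \<in> M i"
          using Mic(3)[OF _ Mic(5)[OF e(1) v(1)]] by blast
        moreover have "(u \<ominus> e \<otimes> v) \<oplus> e \<otimes> v = u"
          using uc vc e(1) by algebra
        ultimately show False
          using u by simp
      qed
      ultimately show ?thesis
        using e M(2)[of i] i by blast
    qed
    show ?thesis
    proof (cases n)
      case (Suc n')
      let ?M = "\<lambda>j. if j < k then M j else M (Suc j) \<inter> N"
      have "ideal (?M i) R \<and> K \<subseteq> ?M i \<and> ?M i \<subseteq> N" if "i \<le> n'" for i
        using that Suc M(1)[of i] M(1)[of "Suc i"] below[of i] N KN i_intersect by auto
      moreover have "?M i \<subset> ?M (Suc i)" if i: "i < n'" for i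
      proof -
        consider "Suc i < k" | "Suc i = k" | "k \<le> i"
          by linarith
        then show ?thesis
        proof cases
          case 1
          then show ?thesis
            using M(2)[of i] i Suc by simp
        next
          case 2
          \<comment> \<open>At the gap the new chain jumps from \<open>M (k - 1)\<close> to
            \<open>M (k + 1) \<inter> N\<close>. Strictness comes from the second half of the jump,
            starting at \<open>M k \<inter> N\<close>.\<close>
          have "M i \<subseteq> M (Suc i) \<inter> N"
            using 2 below[of i] mono[of i "Suc i"] i Suc by auto
          then show ?thesis
            using 2 strict[of "Suc i"] i Suc by auto
        next
          case 3
          then show ?thesis
            using strict[of "Suc i"] i Suc by simp
        qed
      qed
      ultimately have "ideal_chain R K N n'"
        unfolding ideal_chain_def by (intro exI[of _ ?M]) blast
      then show ?thesis
        using bound Suc by force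
    qed simp
  qed
qed

text \<open>Since \<open>\<mm>\<close> multiplies \<open>S\<close> into \<open>K\<close>, each
  generator is simple modulo the ideal generated so far, so adding it lengthens chains by at most
  one. Without generators the top equals \<open>K\<close> and no strict step is left.\<close>

lemma ideal_chain_le_card_generators:
  assumes "finite S" "S \<subseteq> carrier R" "ideal K R"
    and "\<And>c s. c \<in> \<mm> \<Longrightarrow> s \<in> S \<Longrightarrow> c \<otimes> s \<in> K"
    and "ideal_chain R K (Idl (K \<union> S)) n"
  shows "n \<le> card S"
  using assms
proof (induct S arbitrary: n rule: finite_induct)
  case empty
  have "Idl K \<subseteq> K"
    using genideal_minimal[OF assms(3), of K] by simp
  show ?case
  proof (rule ccontr)
    assume "\<not> n \<le> card {}"
    then obtain n' where "n = Suc n'"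
      by (cases n) auto
    with empty(4) obtain M where "\<forall>i\<le>Suc n'. ideal (M i) R \<and> K \<subseteq> M i \<and> M i \<subseteq> Idl (K \<union> {})"
      "\<forall>i<Suc n'. M i \<subset> M (Suc i)"
      unfolding ideal_chain_def by auto
    then have "K \<subseteq> M 0" "M 0 \<subset> M (Suc 0)" "M (Suc 0) \<subseteq> Idl K"
      by (auto simp del: psubset_eq)
    then show False
      using \<open>Idl K \<subseteq> K\<close> by auto
  qed
next
  case (insert s S)
  have KS: "K \<union> S \<subseteq> carrier R"
    using insert(4) ideal_closed(2)[OF assms(3)] by auto
  have s: "s \<in> carrier R"
    using insert(4) by auto
  have N: "ideal (Idl (K \<union> S)) R"
    using genideal_ideal[OF KS] .
  have sub: "K \<union> S \<subseteq> Idl (K \<union> S)"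
    using genideal_self[OF KS] .
  have "n \<le> Suc (card S)"
  proof (rule ideal_chain_simple_step[OF N s _ _ _ _ insert(7)])
    show "c \<otimes> s \<in> Idl (K \<union> S)" if "c \<in> \<mm>" for c
      using insert(6)[OF that, of s] sub by auto
    show "\<exists>c\<in>carrier R. u \<ominus> c \<otimes> s \<in> Idl (K \<union> S)" if "u \<in> Idl (K \<union> insert s S)" for u
      using genideal_insertD[OF N sub s] that by simp
    show "K \<subseteq> Idl (K \<union> S)"
      using sub by auto
    show "m \<le> card S" if "ideal_chain R K (Idl (K \<union> S)) m" for m
      using insert(3)[OF _ assms(3) _ that] insert(4,6) by auto
  qed
  then show ?case
    using insert(1,2) by simp
qed

end

section \<open>Subquotients\<close>

context cring
begin

lemma set_add_cosets:
  assumes "ideal K R" "u \<in> carrier R" "v \<in> carrier R"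
  shows "(K +> u) <+> (K +> v) = K +> (u \<oplus> v)"
  using ideal.a_rcos_sum[OF assms] .

lemma coset_eq_iff:
  assumes "ideal K R" "u \<in> carrier R" "v \<in> carrier R"
  shows "K +> u = K +> v \<longleftrightarrow> u \<ominus> v \<in> K"
  using quotient_eq_iff_same_a_r_cos[OF assms] by auto

lemma coset_zero_iff:
  assumes "ideal K R" "u \<in> carrier R"
  shows "K +> u = K \<longleftrightarrow> u \<in> K"
  using assms by (meson a_rcos_zero ideal.rcos_const_imp_mem)

lemma coset_zero:
  assumes "ideal K R"
  shows "K +> \<zero> = K"
  using coset_zero_iff[OF assms zero_closed] ideal_closed(1)[OF assms] by simp

lemma mem_coset_iff:
  assumes "ideal K R" "u \<in> carrier R"
  shows "v \<in> K +> u \<longleftrightarrow> v \<in> carrier R \<and> v \<ominus> u \<in> K"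
proof
  assume "v \<in> K +> u"
  then obtain k where k: "k \<in> K" "v = k \<oplus> u"
    by (auto simp: a_r_coset_def')
  then have kc: "k \<in> carrier R"
    using ideal_closed(2)[OF assms(1)] by auto
  have "v \<ominus> u = k"
    using k(2) kc assms(2) by (simp add: a_minus_def a_assoc r_neg)
  then show "v \<in> carrier R \<and> v \<ominus> u \<in> K"
    using k kc assms(2) by simp
next
  assume v: "v \<in> carrier R \<and> v \<ominus> u \<in> K"
  then have "v = (v \<ominus> u) \<oplus> u"
    using assms(2) by (simp add: a_minus_def a_assoc l_neg)
  with v show "v \<in> K +> u"
    unfolding a_r_coset_def' by blast
qed

text \<open>The scalar action is defined as a union over all representatives. Two of them differ by
  an element of \<open>K\<close>, so all cosets in the union agree, and the union is not
  empty.\<close>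

lemma subquotient_smult:
  assumes K: "ideal K R" and c: "c \<in> carrier R" and u: "u \<in> carrier R"
  shows "c \<odot>\<^bsub>subquotient R N K\<^esub> (K +> u) = K +> (c \<otimes> u)"
proof -
  have "K +> (c \<otimes> v) = K +> (c \<otimes> u)" if "v \<in> K +> u" for v
  proof -
    have v: "v \<in> carrier R" "v \<ominus> u \<in> K"
      using that mem_coset_iff[OF K u] by auto
    have "c \<otimes> v \<ominus> c \<otimes> u = c \<otimes> (v \<ominus> u)"
      using c u v(1) by algebra
    then show ?thesis
      using coset_eq_iff[OF K, of "c \<otimes> v" "c \<otimes> u"] c u v ideal_closed(5)[OF K c v(2)] by simp
  qed
  moreover have "K +> u \<noteq> {}"
    using mem_coset_iff[OF K u, of u] u ideal_closed(1)[OF K] by (auto simp: a_minus_def r_neg)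
  ultimately have "(\<Union>v\<in>K +> u. K +> (c \<otimes> v)) = K +> (c \<otimes> u)"
    by (metis SUP_eq_const)
  then show ?thesis
    by (simp add: subquotient_def)
qed

lemma subquotient_add:
  assumes "ideal K R" "u \<in> carrier R" "v \<in> carrier R"
  shows "(K +> u) \<oplus>\<^bsub>subquotient R N K\<^esub> (K +> v) = K +> (u \<oplus> v)"
  using set_add_cosets[OF assms] by (simp add: subquotient_def)

lemma subquotient_carrier: "carrier (subquotient R N K) = (\<lambda>u. K +> u) ` N"
  by (simp add: subquotient_def)

lemma subquotient_zero: "\<zero>\<^bsub>subquotient R N K\<^esub> = K"
  by (simp add: subquotient_def)

lemma subquotient_abelian_group:
  assumes K: "ideal K R" and N: "ideal N R"
  shows "abelian_group (subquotient R N K)"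
proof (rule abelian_groupI)
  note Nc = ideal_closed[OF N]
  have car: "u \<in> carrier R" if "u \<in> N" for u
    using that Nc by auto
  show "\<zero>\<^bsub>subquotient R N K\<^esub> \<in> carrier (subquotient R N K)"
    using Nc(1) coset_zero[OF K] unfolding subquotient_carrier subquotient_zero by force
  fix X assume "X \<in> carrier (subquotient R N K)"
  then obtain u where u: "u \<in> N" "X = K +> u"
    by (auto simp: subquotient_carrier)
  show "\<zero>\<^bsub>subquotient R N K\<^esub> \<oplus>\<^bsub>subquotient R N K\<^esub> X = X"
    using subquotient_add[OF K zero_closed, of u N] car[OF u(1)] u(2) coset_zero[OF K]
    by (simp add: subquotient_zero)
  have "(K +> (\<ominus> u)) \<oplus>\<^bsub>subquotient R N K\<^esub> X = \<zero>\<^bsub>subquotient R N K\<^esub>"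
    using subquotient_add[OF K, of "\<ominus> u" u N] car[OF u(1)] u(2) coset_zero[OF K]
    by (simp add: subquotient_zero l_neg)
  moreover have "\<ominus> u \<in> N"
    using Nc(4)[OF Nc(1) u(1)] car[OF u(1)] by (simp add: a_minus_def)
  ultimately show "\<exists>Y\<in>carrier (subquotient R N K). Y \<oplus>\<^bsub>subquotient R N K\<^esub> X = \<zero>\<^bsub>subquotient R N K\<^esub>"
    by (auto simp: subquotient_carrier)
  fix Y assume "Y \<in> carrier (subquotient R N K)"
  then obtain v where v: "v \<in> N" "Y = K +> v"
    by (auto simp: subquotient_carrier)
  show "X \<oplus>\<^bsub>subquotient R N K\<^esub> Y \<in> carrier (subquotient R N K)"
    using subquotient_add[OF K, of u v N] car u v Nc(3)[OF u(1) v(1)]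
    by (simp add: subquotient_carrier)
  show "X \<oplus>\<^bsub>subquotient R N K\<^esub> Y = Y \<oplus>\<^bsub>subquotient R N K\<^esub> X"
    using subquotient_add[OF K, of u v N] subquotient_add[OF K, of v u N] car u v
    by (simp add: a_comm)
  fix Z assume "Z \<in> carrier (subquotient R N K)"
  then obtain w where w: "w \<in> N" "Z = K +> w"
    by (auto simp: subquotient_carrier)
  show "X \<oplus>\<^bsub>subquotient R N K\<^esub> Y \<oplus>\<^bsub>subquotient R N K\<^esub> Z
      = X \<oplus>\<^bsub>subquotient R N K\<^esub> (Y \<oplus>\<^bsub>subquotient R N K\<^esub> Z)"
    using car u v w by (simp add: subquotient_add[OF K] a_assoc)
qed

lemma submodule_subquotient_image:
  assumes K: "ideal K R" and N: "ideal N R" and M: "ideal M R" "M \<subseteq> N"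
  shows "submodule ((\<lambda>u. K +> u) ` M) R (subquotient R N K)"
proof -
  interpret Q: abelian_group "subquotient R N K"
    using subquotient_abelian_group[OF K N] .
  note Mc = ideal_closed[OF M(1)]
  have car: "u \<in> carrier R" if "u \<in> M" for u
    using that Mc by auto
  have "subgroup ((\<lambda>u. K +> u) ` M) (add_monoid (subquotient R N K))"
  proof (rule Q.add.subgroupI)
    show "(\<lambda>u. K +> u) ` M \<subseteq> carrier (subquotient R N K)"
      using M(2) by (auto simp: subquotient_carrier)
    show "(\<lambda>u. K +> u) ` M \<noteq> {}"
      using Mc(1) by auto
    fix X assume "X \<in> (\<lambda>u. K +> u) ` M"
    then obtain u where u: "u \<in> M" "X = K +> u"
      by auto
    have neg: "\<ominus> u \<in> M"
      using Mc(4)[OF Mc(1) u(1)] car[OF u(1)] by (simp add: a_minus_def)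
    have "(K +> (\<ominus> u)) \<oplus>\<^bsub>subquotient R N K\<^esub> X = \<zero>\<^bsub>subquotient R N K\<^esub>"
      using subquotient_add[OF K, of "\<ominus> u" u N] car[OF u(1)] u(2) coset_zero[OF K]
      by (simp add: subquotient_zero l_neg)
    then have "\<ominus>\<^bsub>subquotient R N K\<^esub> X = K +> (\<ominus> u)"
      using u neg M(2) by (intro Q.minus_equality) (auto simp: subquotient_carrier)
    then show "\<ominus>\<^bsub>subquotient R N K\<^esub> X \<in> (\<lambda>u. K +> u) ` M"
      using neg by simp
    fix Y assume "Y \<in> (\<lambda>u. K +> u) ` M"
    then obtain v where v: "v \<in> M" "Y = K +> v"
      by auto
    show "X \<oplus>\<^bsub>subquotient R N K\<^esub> Y \<in> (\<lambda>u. K +> u) ` M"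
      using car u v Mc(3)[OF u(1) v(1)] by (simp add: subquotient_add[OF K])
  qed
  moreover have "c \<odot>\<^bsub>subquotient R N K\<^esub> X \<in> (\<lambda>u. K +> u) ` M"
    if "c \<in> carrier R" "X \<in> (\<lambda>u. K +> u) ` M" for c X
    using that car Mc(5) by (auto simp: subquotient_smult[OF K])
  ultimately show ?thesis
    by (simp add: submodule_def submodule_axioms_def)
qed

lemma ideal_subquotient_preimage:
  assumes K: "ideal K R" and N: "ideal N R" and P: "submodule P R (subquotient R N K)"
  shows "ideal {u \<in> N. K +> u \<in> P} R"
proof -
  interpret P: submodule P R "subquotient R N K"
    by fact
  note Nc = ideal_closed[OF N]
  have car: "u \<in> carrier R" if "u \<in> N" for u
    using that Nc by auto
  show ?thesis
  proof (rule idealI_add_mult)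
    show "{u \<in> N. K +> u \<in> P} \<subseteq> carrier R"
      using car by auto
    show "\<zero> \<in> {u \<in> N. K +> u \<in> P}"
      using P.one_closed Nc(1) coset_zero[OF K] by (simp add: subquotient_zero)
    fix u assume u: "u \<in> {u \<in> N. K +> u \<in> P}"
    {
      fix v assume v: "v \<in> {u \<in> N. K +> u \<in> P}"
      show "u \<oplus> v \<in> {u \<in> N. K +> u \<in> P}"
        using P.m_closed[of "K +> u" "K +> v"] u v car Nc(3) by (simp add: subquotient_add[OF K])
    }
    fix c assume c: "c \<in> carrier R"
    show "c \<otimes> u \<in> {u \<in> N. K +> u \<in> P}"
    proof -
      have "c \<odot>\<^bsub>subquotient R N K\<^esub> (K +> u) \<in> P"
        using u by (intro P.smult_closed c) simp
      then show ?thesis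
        using u car[of u] Nc(5)[OF c, of u] subquotient_smult[OF K c, of u N] by simp
    qed
  qed
qed

text \<open>Images and preimages under the quotient map turn chains of ideals between
  \<open>K\<close> and \<open>N\<close> into chains of submodules of \<open>N/K\<close> and back,
  keeping inclusions strict. The two sets of chain lengths coincide, and \<open>d\<close> is their
  maximum.\<close>

lemma module_length_subquotient:
  assumes K: "ideal K R" and N: "ideal N R" "K \<subseteq> N"
    and chain: "ideal_chain R K N d" and bound: "\<And>n. ideal_chain R K N n \<Longrightarrow> n \<le> d"
  shows "module_length R (subquotient R N K) = enat d"
proof -
  have "ideal_chain R K N n \<longleftrightarrow> (\<exists>P. (\<forall>i\<le>n. submodule (P i) R (subquotient R N K)) \<and>
    (\<forall>i<n. P i \<subset> P (Suc i)))" (is "_ \<longleftrightarrow> (\<exists>P. ?chain P)") for n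
  proof
    assume "ideal_chain R K N n"
    then obtain M where M: "\<And>i. i \<le> n \<Longrightarrow> ideal (M i) R \<and> K \<subseteq> M i \<and> M i \<subseteq> N"
      "\<And>i. i < n \<Longrightarrow> M i \<subset> M (Suc i)"
      unfolding ideal_chain_def by auto
    have "(\<lambda>u. K +> u) ` M i \<subset> (\<lambda>u. K +> u) ` M (Suc i)" if i: "i < n" for i
    proof -
      have Mi: "ideal (M i) R" "K \<subseteq> M i" "ideal (M (Suc i)) R"
        using M(1)[of i] M(1)[of "Suc i"] i by auto
      obtain v where v: "v \<in> M (Suc i)" "v \<notin> M i"
        using M(2)[OF i] by auto
      have vc: "v \<in> carrier R"
        using v ideal_closed(2)[OF Mi(3)] by auto
      \<comment> \<open>As \<open>K\<close> lies in \<open>M i\<close>, an element congruent modulo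
        \<open>K\<close> to one of \<open>M i\<close> would itself be in \<open>M i\<close>.\<close>
      have "K +> v \<notin> (\<lambda>u. K +> u) ` M i"
      proof
        assume "K +> v \<in> (\<lambda>u. K +> u) ` M i"
        then obtain u where u: "u \<in> M i" "K +> v = K +> u"
          by auto
        then have uc: "u \<in> carrier R"
          using ideal_closed(2)[OF Mi(1)] by auto
        have "v \<ominus> u \<in> M i"
          using u coset_eq_iff[OF K vc uc] Mi by auto
        then have "(v \<ominus> u) \<oplus> u \<in> M i"
          using ideal_closed(3)[OF Mi(1)] u by auto
        then show False
          using v uc vc by (simp add: a_minus_def a_assoc l_neg)
      qed
      then show ?thesis
        using v M(2)[OF i] by blast
    qed
    then have "?chain (\<lambda>i. (\<lambda>u. K +> u) ` M i)"
      using submodule_subquotient_image[OF K N(1)] M(1) by simp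
    then show "\<exists>P. ?chain P"
      by (intro exI[of _ "\<lambda>i. (\<lambda>u. K +> u) ` M i"])
  next
    assume "\<exists>P. ?chain P"
    then obtain P where "?chain P" ..
    then have P: "\<And>i. i \<le> n \<Longrightarrow> submodule (P i) R (subquotient R N K)"
      "\<And>i. i < n \<Longrightarrow> P i \<subset> P (Suc i)"
      by simp_all
    let ?M = "\<lambda>i. {u \<in> N. K +> u \<in> P i}"
    have "K \<subseteq> ?M i" if "i \<le> n" for i
    proof
      fix u assume u: "u \<in> K"
      interpret P: submodule "P i" R "subquotient R N K"
        using P(1)[OF that] .
      show "u \<in> ?M i"
        using P.one_closed u N(2) a_rcos_zero[OF K u] by (auto simp: subquotient_zero)
    qed
    moreover have "?M i \<subset> ?M (Suc i)" if i: "i < n" for i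
    proof -
      interpret P: submodule "P (Suc i)" R "subquotient R N K"
        using P(1)[of "Suc i"] i by simp
      obtain X where X: "X \<in> P (Suc i)" "X \<notin> P i"
        using P(2)[OF i] by auto
      then have "X \<in> carrier (subquotient R N K)"
        using P.subset by auto
      then obtain u where u: "u \<in> N" "X = K +> u"
        by (auto simp: subquotient_carrier)
      then show ?thesis
        using X P(2)[OF i] by auto
    qed
    ultimately show "ideal_chain R K N n"
      unfolding ideal_chain_def using ideal_subquotient_preimage[OF K N(1) P(1)]
      by (intro exI[of _ ?M]) auto
  qed
  then have "module_length R (subquotient R N K) = (SUP n\<in>{n. ideal_chain R K N n}. enat n)"
    unfolding module_length_def by simp
  also have "\<dots> = enat d"
    using chain bound by (intro antisym SUP_least SUP_upper) auto
  finally show ?thesis .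
qed

end

section \<open>Dual bases of subquotients\<close>

text \<open>\<open>Z s\<close> is the kernel of the \<open>s\<close>-th coordinate function on \<open>N\<close> and \<open>x\<close> is the dual basis.\<close>

locale dual_basis = noetherian_local_ring +
  fixes N :: "'a set" and S :: "'s set" and Z :: "'s \<Rightarrow> 'a set" and x :: "'s \<Rightarrow> 'a"
  assumes S: "finite S" and N: "ideal N R"
    and Z: "s \<in> S \<Longrightarrow> ideal (Z s) R"
    and x: "s \<in> S \<Longrightarrow> x s \<in> N"
    and x_off: "s \<in> S \<Longrightarrow> t \<in> S \<Longrightarrow> t \<noteq> s \<Longrightarrow> x s \<in> Z t"
    and x_diag: "s \<in> S \<Longrightarrow> x s \<notin> Z s"
    and coord: "s \<in> S \<Longrightarrow> u \<in> N \<Longrightarrow> \<exists>c\<in>carrier R. u \<oplus> c \<otimes> x s \<in> Z s"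
    and residue: "s \<in> S \<Longrightarrow> c \<in> \<mm> \<Longrightarrow> u \<in> N \<Longrightarrow> c \<otimes> u \<in> Z s"
begin

text \<open>It interpolates between \<open>N\<close>, for empty \<open>T\<close>, and the ideal
  modulo which \<open>x\<close> is a basis, for \<open>T = S\<close>.\<close>

definition common_kernel :: "'s set \<Rightarrow> 'a set" where
  "common_kernel T = {u \<in> N. \<forall>s\<in>T. u \<in> Z s}"

lemma common_kernel_ideal:
  assumes "T \<subseteq> S"
  shows "ideal (common_kernel T) R"
proof -
  have "common_kernel T = \<Inter>(insert N (Z ` T))"
    unfolding common_kernel_def by auto
  then show ?thesis
    using assms N Z i_Intersect[of "insert N (Z ` T)"] by auto
qed

text \<open>The coordinates are released one at a time. Releasing \<open>t\<close> gives a strictly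
  larger ideal, as \<open>x t\<close> has nonzero coordinate \<open>t\<close>, and
  \<open>x t\<close> is the only new generator, as its multiples can cancel coordinate
  \<open>t\<close> of any element.\<close>

lemma filtration:
  assumes "T \<subseteq> S"
  shows "ideal_chain R (common_kernel S) (common_kernel (S - T)) (card T) \<and>
    common_kernel (S - T) = Idl (common_kernel S \<union> x ` T)"
  using finite_subset[OF assms S] assms
proof induct
  case empty
  have K: "ideal (common_kernel S) R"
    by (rule common_kernel_ideal) simp
  have "Idl (common_kernel S) = common_kernel S"
    using genideal_minimal[OF K, of "common_kernel S"] genideal_self[OF ideal_closed(2)[OF K]]
    by auto
  moreover have "ideal_chain R (common_kernel S) (common_kernel S) 0"
    unfolding ideal_chain_def using K by auto
  ultimately show ?case
    by simp
next
  case (insert t T)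
  let ?K = "common_kernel S" and ?L = "common_kernel (S - T)"
  let ?L' = "common_kernel (S - insert t T)"
  have t: "t \<in> S" "x t \<in> carrier R"
    using insert x ideal_closed(2)[OF N] by auto
  have L: "ideal ?L R" "ideal ?L' R" and K: "ideal ?K R"
    by (auto intro: common_kernel_ideal)
  note Lc = ideal_closed[OF L(1)] and Lc' = ideal_closed[OF L(2)]
  have IH: "ideal_chain R ?K ?L (card T)" "?L = Idl (?K \<union> x ` T)"
    using insert by auto
  have xt: "x t \<in> ?L'" "x t \<notin> ?L"
    using t(1) x x_off insert(2) x_diag[OF t(1)] insert.prems unfolding common_kernel_def by auto
  have sub: "?L \<subseteq> ?L'"
    unfolding common_kernel_def by auto
  have "ideal_chain R ?K ?L' (Suc (card T))"
    using xt sub by (intro ideal_chain_extend[OF IH(1) L(2)]) auto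
  moreover have "?L' = Idl (?K \<union> x ` insert t T)"
  proof
    have gens: "?K \<union> x ` insert t T \<subseteq> ?L'"
    proof -
      have "x ` T \<subseteq> ?L"
      proof -
        have "x ` T \<subseteq> carrier R"
          using insert.prems x ideal_closed(2)[OF N] by auto
        then show ?thesis
          using IH(2) genideal_self[of "?K \<union> x ` T"] ideal_closed(2)[OF K] by auto
      qed
      then show ?thesis
        using sub xt unfolding common_kernel_def by auto
    qed
    then show "Idl (?K \<union> x ` insert t T) \<subseteq> ?L'"
      using genideal_minimal[OF L(2)] by auto
    have gc: "?K \<union> x ` insert t T \<subseteq> carrier R"
      using gens Lc'(2) by auto
    note Gc = ideal_closed[OF genideal_ideal[OF gc]]
    show "?L' \<subseteq> Idl (?K \<union> x ` insert t T)"
    proof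
      fix u assume u: "u \<in> ?L'"
      then have uc: "u \<in> carrier R" and "u \<in> N"
        using Lc'(2) unfolding common_kernel_def by auto
      \<comment> \<open>The correction clears coordinate \<open>t\<close> and leaves the vanishing
        coordinates in \<open>S - insert t T\<close> at zero, because \<open>x t\<close> lies in
        their kernels.\<close>
      then obtain c where c: "c \<in> carrier R" "u \<oplus> c \<otimes> x t \<in> Z t"
        using coord t(1) by blast
      have "u \<oplus> c \<otimes> x t \<in> ?L'"
        using Lc'(3)[OF u Lc'(5)[OF c(1) xt(1)]] .
      then have "u \<oplus> c \<otimes> x t \<in> ?L"
        using c(2) unfolding common_kernel_def by auto
      also have "?L \<subseteq> Idl (?K \<union> x ` insert t T)"
        unfolding IH(2) using subset_Idl_subset[OF gc, of "?K \<union> x ` T"] by auto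
      finally have "(u \<oplus> c \<otimes> x t) \<ominus> c \<otimes> x t \<in> Idl (?K \<union> x ` insert t T)"
        using Gc(4)[OF _ Gc(5)[OF c(1)]] genideal_self[OF gc] by auto
      moreover have "(u \<oplus> c \<otimes> x t) \<ominus> c \<otimes> x t = u"
        using uc c(1) t(2) by algebra
      ultimately show "u \<in> Idl (?K \<union> x ` insert t T)"
        by simp
    qed
  qed
  ultimately show ?case
    using insert by simp
qed

lemma residue_common_kernel:
  assumes "c \<in> \<mm>" "u \<in> N"
  shows "c \<otimes> u \<in> common_kernel S"
  unfolding common_kernel_def
  using residue assms ideal_closed(5)[OF N] ideal_closed(2)[OF \<mm>_ideal] by auto

lemma common_kernel_empty: "common_kernel {} = N"
  unfolding common_kernel_def by auto

lemma chain_common_kernel: "ideal_chain R (common_kernel S) N (card S)"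
  and generators: "N = Idl (common_kernel S \<union> x ` S)"
  using filtration[OF subset_refl] by (auto simp: common_kernel_empty)

text \<open>A generator in \<open>N\<close> is multiplied by \<open>\<mm>\<close> into the common
  kernel, so generators modulo that kernel bound every chain above it, in particular the one of
  length \<open>card S\<close>.\<close>

lemma card_le_card_generators:
  assumes "T \<subseteq> carrier R" "finite T" "N = Idl (common_kernel S \<union> T)"
  shows "card S \<le> card T" and "ideal_chain R (common_kernel S) N n \<Longrightarrow> n \<le> card T"
proof -
  have K: "ideal (common_kernel S) R"
    by (rule common_kernel_ideal) simp
  have TN: "T \<subseteq> N"
    using genideal_self[of "common_kernel S \<union> T"] assms ideal_closed(2)[OF K] by auto
  show "n \<le> card T" if "ideal_chain R (common_kernel S) N n" for n
    using ideal_chain_le_card_generators[OF assms(2,1) K] residue_common_kernel TN that assms(3)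
    by auto
  then show "card S \<le> card T"
    using chain_common_kernel by blast
qed

text \<open>The chain from the filtration is longest possible because the dual basis itself
  generates \<open>N\<close> modulo the common kernel.\<close>

lemma module_length_eq: "module_length R (subquotient R N (common_kernel S)) = enat (card S)"
proof (rule module_length_subquotient)
  show "ideal (common_kernel S) R"
    by (rule common_kernel_ideal) simp
  show "ideal N R" "common_kernel S \<subseteq> N" "ideal_chain R (common_kernel S) N (card S)"
    using N chain_common_kernel unfolding common_kernel_def by auto
  fix n assume "ideal_chain R (common_kernel S) N n"
  moreover have "x ` S \<subseteq> carrier R"
    using x ideal_closed(2)[OF N] by auto
  ultimately have "n \<le> card (x ` S)"
    using card_le_card_generators(2) generators S by blast
  then show "n \<le> card S"
    using card_image_le[OF S, of x] by linarith
qed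

text \<open>For \<open>s\<close> outside \<open>T\<close> the element \<open>x s\<close> has zero
  coordinates in \<open>T\<close>, so it already lies in the smaller ideal. This makes the length of
  a kernel, such as the torsion part, another instance of the count above.\<close>

lemma dual_basis_common_kernel:
  assumes T: "T \<subseteq> S"
  shows "dual_basis R \<mm> (common_kernel T) (S - T) Z x"
proof (intro dual_basis.intro dual_basis_axioms.intro noetherian_local_ring_axioms)
  show "finite (S - T)" "ideal (common_kernel T) R"
    using S common_kernel_ideal[OF T] by auto
  have sub: "u \<in> N" if "u \<in> common_kernel T" for u
    using that unfolding common_kernel_def by auto
  fix s assume s: "s \<in> S - T"
  then show "ideal (Z s) R" "x s \<notin> Z s"
    using Z x_diag by auto
  show "x s \<in> common_kernel T"
    using s x x_off T unfolding common_kernel_def by auto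
  show "x s \<in> Z t" if "t \<in> S - T" "t \<noteq> s" for t
    using s that x_off by auto
  fix u assume u: "u \<in> common_kernel T"
  show "\<exists>c\<in>carrier R. u \<oplus> c \<otimes> x s \<in> Z s"
    using coord s sub[OF u] by auto
  show "c \<otimes> u \<in> Z s" if "c \<in> \<mm>" for c
    using residue s sub[OF u] that by auto
qed

lemma module_length_common_kernel:
  assumes T: "T \<subseteq> S"
  shows "module_length R (subquotient R (common_kernel T) (common_kernel S)) = enat (card (S - T))"
proof -
  note B = dual_basis_common_kernel[OF T]
  have "dual_basis.common_kernel (common_kernel T) Z (S - T) = common_kernel S"
    using T unfolding dual_basis.common_kernel_def[OF B] unfolding common_kernel_def by auto
  then show ?thesis
    using dual_basis.module_length_eq[OF B] by simp
qed

text \<open>The dual basis generates \<open>N\<close> modulo \<open>\<mm> N\<close>, hence generates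
  \<open>N\<close> by Nakayama's lemma. Conversely any finite generating set also generates modulo
  the common kernel and so has at least \<open>card S\<close> elements.\<close>

lemma min_num_gens_eq:
  assumes "common_kernel S = \<mm> \<cdot> N"
  shows "min_num_gens R N = card S"
  unfolding min_num_gens_def
proof (rule Least_equality)
  have xS: "x ` S \<subseteq> N" "x ` S \<subseteq> carrier R"
    using x ideal_closed(2)[OF N] by auto
  have "inj_on x S"
    using x_off x_diag by (metis inj_onI)
  then have "card (x ` S) = card S"
    by (rule card_image)
  moreover have "N = Idl (x ` S)"
  proof (rule nakayama[OF N genideal_ideal[OF xS(2)] genideal_minimal[OF N xS(1)]])
    have "\<mm> \<cdot> N \<union> Idl (x ` S) \<subseteq> carrier R"
      using ideal_prod_in_carrier[OF \<mm>_ideal N] ideal_closed(2)[OF genideal_ideal[OF xS(2)]] by auto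
    moreover have "\<mm> \<cdot> N \<union> x ` S \<subseteq> \<mm> \<cdot> N \<union> Idl (x ` S)"
      using genideal_self[OF xS(2)] by auto
    ultimately show "N \<subseteq> Idl (\<mm> \<cdot> N \<union> Idl (x ` S))"
      using generators subset_Idl_subset unfolding assms by blast
  qed
  ultimately show "\<exists>T\<subseteq>carrier R. finite T \<and> card T = card S \<and> Idl T = N"
    using xS S by blast
next
  fix n assume "\<exists>T\<subseteq>carrier R. finite T \<and> card T = n \<and> Idl T = N"
  then obtain T where T: "T \<subseteq> carrier R" "finite T" "card T = n" "Idl T = N"
    by auto
  have K: "common_kernel S \<subseteq> N"
    unfolding common_kernel_def by auto
  have KT: "common_kernel S \<union> T \<subseteq> carrier R"
    using T(1) K ideal_closed(2)[OF N] by auto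
  have "N \<subseteq> Idl (common_kernel S \<union> T)"
    using subset_Idl_subset[OF KT, of T] T(4) by auto
  moreover have "Idl (common_kernel S \<union> T) \<subseteq> N"
    using genideal_minimal[OF N, of "common_kernel S \<union> T"] K genideal_self[OF T(1)] T(4) by auto
  ultimately show "card S \<le> n"
    using card_le_card_generators(1)[of T] T by auto
qed

end

section \<open>Powers of ideals\<close>

lemma ideal_prod_mono:
  assumes "I \<subseteq> I'" "J \<subseteq> J'"
  shows "I \<cdot>\<^bsub>R\<^esub> J \<subseteq> I' \<cdot>\<^bsub>R\<^esub> J'"
proof
  fix s assume "s \<in> I \<cdot>\<^bsub>R\<^esub> J"
  then show "s \<in> I' \<cdot>\<^bsub>R\<^esub> J'"
    by induct (use assms in \<open>auto intro: ideal_prod.intros\<close>)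
qed

context cring
begin

lemma ideal_pow_0: "ideal_pow R L 0 = carrier R"
  by (simp add: nat_pow_def ideals_set_def)

lemma ideal_pow_Suc: "ideal_pow R L (Suc n) = ideal_pow R L n \<cdot> L"
  by (simp add: nat_pow_def ideals_set_def)

lemma ideal_pow_ideal:
  assumes "ideal L R"
  shows "ideal (ideal_pow R L n) R"
  by (induct n) (simp_all only: ideal_pow_0 ideal_pow_Suc oneideal ideal_prod_is_ideal assms)

lemma ideal_pow_add:
  assumes "ideal L R"
  shows "ideal_pow R L (n + k) = ideal_pow R L n \<cdot> ideal_pow R L k"
proof (induct k)
  case 0
  then show ?case
    using ideal_prod_one[OF ideal_pow_ideal[OF assms]] by (simp only: ideal_pow_0 add_0_right)
next
  case (Suc k)
  then show ?case
    using ideal_prod_assoc[OF ideal_pow_ideal[OF assms] ideal_pow_ideal[OF assms] assms]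
    by (simp only: add_Suc_right ideal_pow_Suc)
qed

lemma ideal_pow_mono:
  assumes "J \<subseteq> I"
  shows "ideal_pow R J n \<subseteq> ideal_pow R I n"
  by (induct n) (simp_all only: ideal_pow_0 ideal_pow_Suc ideal_prod_mono assms order_refl)

text \<open>The natural map from cosets of \<open>K\<close> to cosets of \<open>K'\<close>;
  \<open>fiber_incl\<close> applies it in each degree.\<close>

lemma set_add_coset_absorb:
  assumes K': "ideal K' R" and K: "ideal K R" "K \<subseteq> K'" and u: "u \<in> carrier R"
  shows "K' <+> (K +> u) = K' +> u"
proof -
  have "K' <+> K = Idl (K' \<union> K)"
    using union_genideal[OF K' K(1)] by simp
  also have "K' \<union> K = K'"
    using K(2) by auto
  also have "Idl K' = K'"
    using genideal_minimal[OF K', of K'] genideal_self ideal_closed(2)[OF K'] by blast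
  finally show ?thesis
    using a_setmult_rcos_assoc[of K' K u] ideal_closed(2)[OF K'] ideal_closed(2)[OF K(1)] u by simp
qed

end

section \<open>Arithmetic of the fiber cone\<close>

locale fiber = noetherian_local_ring +
  fixes L :: "'a set"
  assumes L: "ideal L R"
begin

abbreviation P :: "nat \<Rightarrow> 'a set" where
  "P n \<equiv> ideal_pow R L n"

abbreviation Q :: "nat \<Rightarrow> 'a set" where
  "Q n \<equiv> \<mm> \<cdot> P n"

abbreviation F :: "(nat \<Rightarrow> 'a set) ring" where
  "F \<equiv> fiber_cone R \<mm> L"

abbreviation cls :: "nat \<Rightarrow> 'a \<Rightarrow> nat \<Rightarrow> 'a set" where
  "cls n u \<equiv> fiber_class R \<mm> L n u"

lemma P_ideal: "ideal (P n) R"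
  using ideal_pow_ideal[OF L] .

lemma Q_ideal: "ideal (Q n) R"
  using ideal_prod_is_ideal[OF \<mm>_ideal P_ideal] .

lemma Q_subset: "Q n \<subseteq> P n"
  using ideal_prod_inter[OF \<mm>_ideal P_ideal] by auto

lemma P_carrier: "u \<in> P n \<Longrightarrow> u \<in> carrier R"
  using ideal_closed(2)[OF P_ideal] by auto

lemma Q_carrier: "u \<in> Q n \<Longrightarrow> u \<in> carrier R"
  using ideal_closed(2)[OF Q_ideal] by auto

lemma mult_P:
  assumes "u \<in> P n" "v \<in> P k"
  shows "u \<otimes> v \<in> P (n + k)"
  unfolding ideal_pow_add[OF L] using assms by (rule ideal_prod.prod)

lemma mult_Q:
  assumes "u \<in> Q n" "v \<in> P k"
  shows "u \<otimes> v \<in> Q (n + k)"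
proof -
  have "Q (n + k) = Q n \<cdot> P k"
    unfolding ideal_pow_add[OF L] using ideal_prod_assoc[OF \<mm>_ideal P_ideal P_ideal] by simp
  then show ?thesis
    using assms by (auto intro: ideal_prod.prod)
qed

lemma mult_Q':
  assumes "u \<in> P n" "v \<in> Q k"
  shows "u \<otimes> v \<in> Q (n + k)"
  using mult_Q[OF assms(2,1)] P_carrier[OF assms(1)] Q_carrier[OF assms(2)]
  by (simp add: m_comm add.commute)

text \<open>The factors are cosets of different ideals and the product is taken modulo a third. It
  is well defined because \<open>b d - u v = (b - u) d + u (d - v)\<close>, with both terms in
  \<open>\<mm> L^(n+k)\<close>.\<close>

lemma coset_mult:
  assumes u: "u \<in> P n" and v: "v \<in> P k"
  shows "rcoset_mult R (Q (n + k)) (Q n +> u) (Q k +> v) = Q (n + k) +> (u \<otimes> v)"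
proof -
  have uc: "u \<in> carrier R" and vc: "v \<in> carrier R"
    using u v P_carrier by auto
  have eq: "Q (n + k) +> (b \<otimes> d) = Q (n + k) +> (u \<otimes> v)" if "b \<in> Q n +> u" "d \<in> Q k +> v" for b d
  proof -
    have b: "b \<in> carrier R" "b \<ominus> u \<in> Q n" and d: "d \<in> carrier R" "d \<ominus> v \<in> Q k"
      using that mem_coset_iff[OF Q_ideal] uc vc by auto
    have "(d \<ominus> v) \<oplus> v \<in> P k"
      using ideal_closed(3)[OF P_ideal _ v] d(2) Q_subset by blast
    then have "d \<in> P k"
      using d(1) vc by (simp add: a_minus_def a_assoc l_neg)
    then have "(b \<ominus> u) \<otimes> d \<oplus> u \<otimes> (d \<ominus> v) \<in> Q (n + k)"
      using ideal_closed(3)[OF Q_ideal] mult_Q[OF b(2)] mult_Q'[OF u d(2)] by blast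
    also have "(b \<ominus> u) \<otimes> d \<oplus> u \<otimes> (d \<ominus> v) = b \<otimes> d \<ominus> u \<otimes> v"
      using b(1) d(1) uc vc by algebra
    finally show ?thesis
      using coset_eq_iff[OF Q_ideal] b(1) d(1) uc vc by simp
  qed
  have "u \<in> Q n +> u" "v \<in> Q k +> v"
    using mem_coset_iff[OF Q_ideal] ideal_closed(1)[OF Q_ideal] uc vc
    by (simp_all add: a_minus_def r_neg)
  then have ne: "Q n +> u \<noteq> {}" "Q k +> v \<noteq> {}"
    by auto
  have "(\<Union>d\<in>Q k +> v. Q (n + k) +> (b \<otimes> d)) = Q (n + k) +> (u \<otimes> v)" if "b \<in> Q n +> u" for b
    using ne(2) eq[OF that] by (rule SUP_eq_const)
  with ne(1) show ?thesis
    unfolding rcoset_mult_def by (rule SUP_eq_const)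
qed

lemma piece_group: "abelian_group (fiber_piece R \<mm> L n)"
  using subquotient_abelian_group[OF Q_ideal P_ideal] .

lemma piece_carrier: "carrier (fiber_piece R \<mm> L n) = (\<lambda>u. Q n +> u) ` P n"
  by (rule subquotient_carrier)

lemma piece_zero: "\<zero>\<^bsub>fiber_piece R \<mm> L n\<^esub> = Q n"
  by (rule subquotient_zero)

lemma zero_in_piece: "Q n \<in> (\<lambda>u. Q n +> u) ` P n"
  using coset_zero[OF Q_ideal] ideal_closed(1)[OF P_ideal] by (intro image_eqI[of _ _ \<zero>]) simp_all

lemma coset_mult_zero:
  assumes "X \<in> (\<lambda>u. Q n +> u) ` P n"
  shows "rcoset_mult R (Q (n + k)) X (Q k) = Q (n + k)"
    and "rcoset_mult R (Q (k + n)) (Q k) X = Q (k + n)"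
proof -
  obtain u where u: "u \<in> P n" "X = Q n +> u"
    using assms by auto
  show "rcoset_mult R (Q (n + k)) X (Q k) = Q (n + k)"
    using coset_mult[OF u(1) ideal_closed(1)[OF P_ideal], of k] u P_carrier coset_zero[OF Q_ideal]
    by simp
  show "rcoset_mult R (Q (k + n)) (Q k) X = Q (k + n)"
    using coset_mult[OF ideal_closed(1)[OF P_ideal] u(1), of k] u P_carrier coset_zero[OF Q_ideal]
    by simp
qed

lemma coset_mult_closed:
  assumes "X \<in> (\<lambda>u. Q n +> u) ` P n" "Y \<in> (\<lambda>u. Q k +> u) ` P k"
  shows "rcoset_mult R (Q (n + k)) X Y \<in> (\<lambda>u. Q (n + k) +> u) ` P (n + k)"
proof -
  obtain u v where uv: "u \<in> P n" "X = Q n +> u" "v \<in> P k" "Y = Q k +> v"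
    using assms by blast
  show ?thesis
    unfolding uv(2,4) coset_mult[OF uv(1,3)] using mult_P[OF uv(1,3)] by (rule imageI)
qed

section \<open>The fiber cone as a graded abelian group\<close>

lemma F_carrier:
  "carrier F = {x. (\<forall>n. x n \<in> (\<lambda>u. Q n +> u) ` P n) \<and> finite {n. x n \<noteq> Q n}}"
  by (simp add: fiber_cone_def piece_carrier piece_zero)

lemma F_zero: "\<zero>\<^bsub>F\<^esub> = Q"
  by (simp add: fiber_cone_def piece_zero)

lemma F_add: "x \<oplus>\<^bsub>F\<^esub> y = (\<lambda>n. x n <+> y n)"
  by (simp add: fiber_cone_def subquotient_def)

lemma cls_eq: "cls n u = (\<lambda>k. if k = n then Q n +> u else Q k)"
  by (simp add: fiber_class_def piece_zero fun_eq_iff)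

text \<open>The laws hold degree by degree. What remains is finiteness of supports, for which
  \<open>carI\<close> accepts any finite set containing the support.\<close>

lemma F_group: "abelian_group F"
proof (rule abelian_groupI)
  have add: "(x \<oplus>\<^bsub>F\<^esub> y) n = x n \<oplus>\<^bsub>fiber_piece R \<mm> L n\<^esub> y n" for x y n
    by (simp add: fiber_cone_def)
  have piece: "x n \<in> carrier (fiber_piece R \<mm> L n)" if "x \<in> carrier F" for x n
    using that by (simp add: fiber_cone_def)
  have carI: "x \<in> carrier F" if "\<And>n. x n \<in> carrier (fiber_piece R \<mm> L n)"
    "{n. x n \<noteq> \<zero>\<^bsub>fiber_piece R \<mm> L n\<^esub>} \<subseteq> S" "finite S" for x S
    using that finite_subset by (simp add: fiber_cone_def)
  have supp: "finite {n. x n \<noteq> \<zero>\<^bsub>fiber_piece R \<mm> L n\<^esub>}" if "x \<in> carrier F" for x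
    using that by (simp add: fiber_cone_def)
  have zero: "\<zero>\<^bsub>F\<^esub> n = \<zero>\<^bsub>fiber_piece R \<mm> L n\<^esub>" for n
    by (simp add: fiber_cone_def)
  interpret piece: abelian_group "fiber_piece R \<mm> L n" for n
    by (rule piece_group)
  show "\<zero>\<^bsub>F\<^esub> \<in> carrier F"
    by (rule carI[where S = "{}"]) (simp_all add: zero)
  fix x assume x: "x \<in> carrier F"
  show "\<zero>\<^bsub>F\<^esub> \<oplus>\<^bsub>F\<^esub> x = x"
    using piece[OF x] by (intro ext) (simp add: add zero)
  let ?y = "\<lambda>n. \<ominus>\<^bsub>fiber_piece R \<mm> L n\<^esub> x n"
  have "?y \<in> carrier F"
    using piece[OF x] supp[OF x] by (intro carI[where S = "{n. x n \<noteq> \<zero>\<^bsub>fiber_piece R \<mm> L n\<^esub>}"]) auto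
  moreover have "?y \<oplus>\<^bsub>F\<^esub> x = \<zero>\<^bsub>F\<^esub>"
    using piece[OF x] by (intro ext) (simp add: add zero piece.l_neg)
  ultimately show "\<exists>y\<in>carrier F. y \<oplus>\<^bsub>F\<^esub> x = \<zero>\<^bsub>F\<^esub>"
    by auto
  fix y assume y: "y \<in> carrier F"
  show "x \<oplus>\<^bsub>F\<^esub> y \<in> carrier F"
    using piece[OF x] piece[OF y] supp[OF x] supp[OF y]
    by (intro carI[where S = "{n. x n \<noteq> \<zero>\<^bsub>fiber_piece R \<mm> L n\<^esub>} \<union>
          {n. y n \<noteq> \<zero>\<^bsub>fiber_piece R \<mm> L n\<^esub>}"]) (auto simp: add)
  show "x \<oplus>\<^bsub>F\<^esub> y = y \<oplus>\<^bsub>F\<^esub> x"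
    using piece[OF x] piece[OF y] by (intro ext) (simp add: add piece.a_comm)
  fix z assume z: "z \<in> carrier F"
  show "x \<oplus>\<^bsub>F\<^esub> y \<oplus>\<^bsub>F\<^esub> z = x \<oplus>\<^bsub>F\<^esub> (y \<oplus>\<^bsub>F\<^esub> z)"
    using piece[OF x] piece[OF y] piece[OF z] by (intro ext) (simp add: add piece.a_assoc)
qed

lemma cls_carrier:
  assumes "u \<in> P n"
  shows "cls n u \<in> carrier F"
proof -
  have "{k. cls n u k \<noteq> Q k} \<subseteq> {n}"
    by (auto simp: cls_eq)
  then have "finite {k. cls n u k \<noteq> Q k}"
    using finite_subset by blast
  then show ?thesis
    using assms zero_in_piece by (auto simp: F_carrier cls_eq)
qed

lemma degree_eq: "fiber_degree R \<mm> L n = cls n ` P n"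
proof
  show "cls n ` P n \<subseteq> fiber_degree R \<mm> L n"
    using cls_carrier by (auto simp: fiber_degree_def cls_eq piece_zero)
  show "fiber_degree R \<mm> L n \<subseteq> cls n ` P n"
  proof
    fix x assume x: "x \<in> fiber_degree R \<mm> L n"
    then have "x n \<in> (\<lambda>u. Q n +> u) ` P n" "\<And>k. k \<noteq> n \<Longrightarrow> x k = Q k"
      by (auto simp: fiber_degree_def F_carrier piece_zero)
    then obtain u where "u \<in> P n" "x n = Q n +> u"
      by auto
    moreover have "x = cls n u"
      using calculation \<open>\<And>k. k \<noteq> n \<Longrightarrow> x k = Q k\<close> by (simp add: cls_eq fun_eq_iff)
    ultimately show "x \<in> cls n ` P n"
      by auto
  qed
qed

lemma cls_add:
  assumes "u \<in> P n" "v \<in> P n"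
  shows "cls n u \<oplus>\<^bsub>F\<^esub> cls n v = cls n (u \<oplus> v)"
proof -
  have "Q k <+> Q k = Q k" for k
    using set_add_cosets[OF Q_ideal zero_closed zero_closed, of k] coset_zero[OF Q_ideal] by simp
  then show ?thesis
    using assms P_carrier by (simp add: F_add cls_eq set_add_cosets[OF Q_ideal] fun_eq_iff)
qed

lemma cls_zero_iff:
  assumes "u \<in> P n"
  shows "cls n u = \<zero>\<^bsub>F\<^esub> \<longleftrightarrow> u \<in> Q n"
  using coset_zero_iff[OF Q_ideal P_carrier[OF assms]] by (auto simp: cls_eq F_zero fun_eq_iff)

lemma cls_zero: "cls n \<zero> = \<zero>\<^bsub>F\<^esub>"
  using cls_zero_iff[OF ideal_closed(1)[OF P_ideal]] ideal_closed(1)[OF Q_ideal] by simp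

section \<open>Products with homogeneous classes\<close>

lemma mult_coefficient:
  "(x \<otimes>\<^bsub>F\<^esub> y) n = (\<Oplus>\<^bsub>fiber_piece R \<mm> L n\<^esub>k\<in>{..n}. rcoset_mult R (Q n) (x k) (y (n - k)))"
  by (simp add: fiber_cone_def)

lemma piece_sum_singleton:
  assumes "i \<le> n" "\<And>k. k \<le> n \<Longrightarrow> k \<noteq> i \<Longrightarrow> f k = Q n" "f i \<in> (\<lambda>u. Q n +> u) ` P n"
  shows "(\<Oplus>\<^bsub>fiber_piece R \<mm> L n\<^esub>k\<in>{..n}. f k) = f i"
proof -
  interpret piece: abelian_group "fiber_piece R \<mm> L n"
    by (rule piece_group)
  have f: "f \<in> {..n} \<rightarrow> carrier (fiber_piece R \<mm> L n)"
  proof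
    fix k assume "k \<in> {..n}"
    then show "f k \<in> carrier (fiber_piece R \<mm> L n)"
      using assms zero_in_piece by (cases "k = i") (simp_all add: piece_carrier)
  qed
  have "(\<Oplus>\<^bsub>fiber_piece R \<mm> L n\<^esub>k\<in>{..n}. f k)
    = (\<Oplus>\<^bsub>fiber_piece R \<mm> L n\<^esub>k\<in>{..n}. if i = k then f k else \<zero>\<^bsub>fiber_piece R \<mm> L n\<^esub>)"
    using assms zero_in_piece
    by (intro piece.finsum_cong') (auto simp: piece_zero piece_carrier)
  also have "\<dots> = f i"
    using assms(1) f by (intro piece.finsum_singleton) auto
  finally show ?thesis .
qed

lemma piece_sum_zero:
  assumes "\<And>k. k \<le> n \<Longrightarrow> f k = Q n"
  shows "(\<Oplus>\<^bsub>fiber_piece R \<mm> L n\<^esub>k\<in>{..n}. f k) = Q n"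
  using piece_sum_singleton[of 0 n f] assms zero_in_piece by simp

text \<open>With a left factor concentrated in degree \<open>n\<close>, only the term of index
  \<open>n\<close> of the convolution can be nonzero, so the product is a coefficientwise product
  shifted by \<open>n\<close>.\<close>

lemma cls_mult_left:
  assumes u: "u \<in> P n" and y: "y \<in> carrier F"
  shows "(cls n u \<otimes>\<^bsub>F\<^esub> y) k =
    (if k < n then Q k else rcoset_mult R (Q k) (Q n +> u) (y (k - n)))"
proof -
  have yk: "y i \<in> (\<lambda>u. Q i +> u) ` P i" for i
    using y by (simp add: F_carrier)
  have off: "rcoset_mult R (Q k) (cls n u i) (y (k - i)) = Q k" if "i \<le> k" "i \<noteq> n" for i
    using coset_mult_zero(2)[OF yk, of i "k - i"] that by (simp add: cls_eq)
  show ?thesis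
  proof (cases "k < n")
    case True
    then show ?thesis
      using off by (simp add: mult_coefficient piece_sum_zero)
  next
    case False
    then have "rcoset_mult R (Q k) (cls n u n) (y (k - n)) \<in> (\<lambda>u. Q k +> u) ` P k"
      using coset_mult_closed[of "Q n +> u" n "y (k - n)" "k - n"] yk u by (simp add: cls_eq)
    then show ?thesis
      using False off piece_sum_singleton[of n k "\<lambda>i. rcoset_mult R (Q k) (cls n u i) (y (k - i))"]
      by (simp add: mult_coefficient cls_eq)
  qed
qed

lemma cls_mult_right:
  assumes u: "u \<in> P n" and y: "y \<in> carrier F"
  shows "(y \<otimes>\<^bsub>F\<^esub> cls n u) k =
    (if k < n then Q k else rcoset_mult R (Q k) (y (k - n)) (Q n +> u))"
proof -
  have yk: "y i \<in> (\<lambda>u. Q i +> u) ` P i" for i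
    using y by (simp add: F_carrier)
  have off: "rcoset_mult R (Q k) (y i) (cls n u (k - i)) = Q k" if "i \<le> k" "k - i \<noteq> n" for i
    using coset_mult_zero(1)[OF yk, of i "k - i"] that by (simp add: cls_eq)
  show ?thesis
  proof (cases "k < n")
    case True
    then show ?thesis
      using off by (simp add: mult_coefficient piece_sum_zero)
  next
    case False
    then have "rcoset_mult R (Q k) (y (k - n)) (cls n u n) \<in> (\<lambda>u. Q k +> u) ` P k"
      using coset_mult_closed[of "y (k - n)" "k - n" "Q n +> u" n] yk u by (simp add: cls_eq)
    moreover have "rcoset_mult R (Q k) (y i) (cls n u (k - i)) = Q k"
      if "i \<le> k" "i \<noteq> k - n" for i
      using that False by (intro off) auto
    ultimately show ?thesis
      using False
        piece_sum_singleton[of "k - n" k "\<lambda>i. rcoset_mult R (Q k) (y i) (cls n u (k - i))"]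
      by (simp add: mult_coefficient cls_eq)
  qed
qed

lemma cls_mult:
  assumes "u \<in> P n" "v \<in> P k"
  shows "cls n u \<otimes>\<^bsub>F\<^esub> cls k v = cls (n + k) (u \<otimes> v)"
proof
  fix i
  have uX: "Q n +> u \<in> (\<lambda>u. Q n +> u) ` P n"
    using assms by auto
  have "rcoset_mult R (Q i) (Q n +> u) (cls k v (i - n)) = cls (n + k) (u \<otimes> v) i" if "n \<le> i"
  proof (cases "i = n + k")
    case True
    then show ?thesis
      using coset_mult[OF assms] by (simp add: cls_eq)
  next
    case False
    then have "i - n \<noteq> k"
      using that by auto
    then show ?thesis
      using coset_mult_zero(1)[OF uX, of "i - n"] False that by (simp add: cls_eq)
  qed
  then show "(cls n u \<otimes>\<^bsub>F\<^esub> cls k v) i = cls (n + k) (u \<otimes> v) i"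
    using cls_mult_left[OF assms(1) cls_carrier[OF assms(2)]] by (auto simp: cls_eq)
qed

text \<open>In every degree the coset of \<open>\<mm> J^k\<close> is absorbed by the larger ideal
  \<open>\<mm> L^k\<close>. For \<open>J = L\<close> this says that the module action of the fiber
  cone on itself is its multiplication.\<close>

lemma incl_cls:
  assumes "J \<subseteq> L" "ideal J R" "u \<in> ideal_pow R J n"
  shows "fiber_incl R \<mm> L (fiber_class R \<mm> J n u) = cls n u"
proof -
  interpret J: fiber R \<mm> J
    by (intro fiber.intro fiber_axioms.intro noetherian_local_ring_axioms assms(2))
  have QJ: "J.Q k \<subseteq> Q k" for k
    using ideal_prod_mono[OF order_refl ideal_pow_mono[OF assms(1)]] .
  have "Q k <+> J.Q k = Q k" for k
    using set_add_coset_absorb[OF Q_ideal J.Q_ideal QJ zero_closed, of k]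
    unfolding coset_zero[OF Q_ideal] coset_zero[OF J.Q_ideal] .
  moreover have "Q n <+> (J.Q n +> u) = Q n +> u"
    using set_add_coset_absorb[OF Q_ideal J.Q_ideal QJ J.P_carrier[OF assms(3)]] .
  ultimately show ?thesis
    by (simp add: fiber_incl_def J.cls_eq cls_eq fun_eq_iff)
qed

end

section \<open>Coordinates on graded modules\<close>

text \<open>\<open>Z s x\<close> says that the \<open>s\<close>-th coordinate of \<open>x\<close> vanishes, \<open>C\<close> is the set of scalars of degree
  zero, and \<open>T\<close> collects the coordinates on which the scalar \<open>b\<close> acts injectively; \<open>b\<close> kills the
  others. Coordinates are only compared with zero since those of the free and of the torsion
  summands have different types.\<close>

locale coord_system =
  fixes C :: "'r set" and b :: 'r and M :: "('r, 'x) gmodule" (structure) and i :: nat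
    and S T :: "'s set" and Z :: "'s \<Rightarrow> 'x \<Rightarrow> bool"
  assumes finite: "finite S" and subset: "T \<subseteq> S"
    and zero: "\<zero> \<in> homog M i"
    and add: "s \<in> S \<Longrightarrow> x \<in> homog M i \<Longrightarrow> y \<in> homog M i \<Longrightarrow> Z s x \<Longrightarrow> Z s y \<Longrightarrow> Z s (x \<oplus> y)"
    and smult: "s \<in> S \<Longrightarrow> c \<in> C \<Longrightarrow> x \<in> homog M i \<Longrightarrow> Z s x \<Longrightarrow> Z s (c \<odot> x)"
    and zero_iff: "x \<in> homog M i \<Longrightarrow> x = \<zero> \<longleftrightarrow> (\<forall>s\<in>S. Z s x)"
    and power_iff: "x \<in> homog M i \<Longrightarrow> b \<odot> x = \<zero> \<longleftrightarrow> (\<forall>s\<in>T. Z s x)"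
    and dual: "s \<in> S \<Longrightarrow> \<exists>e\<in>homog M i. \<not> Z s e \<and> (\<forall>t\<in>S - {s}. Z t e) \<and>
      (\<forall>x\<in>homog M i. \<exists>c\<in>C. Z s (x \<oplus> c \<odot> e))"

lemma coord_system_trivial:
  fixes M (structure)
  assumes "homog M i = {\<zero>}" "b \<odot> \<zero> = \<zero>"
  shows "coord_system C b M i {} {} Z"
  using assms by (simp add: coord_system_def)

text \<open>A component of dimension one, with the identity as its coordinate. The flag
  \<open>free\<close> records whether \<open>b\<close> acts on it injectively or as zero.\<close>

lemma coord_system_line:
  fixes M (structure)
  assumes "\<zero> \<in> homog M i" "\<zero> \<oplus> \<zero> = \<zero>" "\<And>c. c \<in> C \<Longrightarrow> c \<odot> \<zero> = \<zero>"
    and "e \<in> homog M i" "e \<noteq> \<zero>" "\<And>x. x \<in> homog M i \<Longrightarrow> \<exists>c\<in>C. x \<oplus> c \<odot> e = \<zero>"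
    and "\<And>x. x \<in> homog M i \<Longrightarrow> b \<odot> x = \<zero> \<longleftrightarrow> (free \<longrightarrow> x = \<zero>)"
  shows "coord_system C b M i {()} (if free then {()} else {}) (\<lambda>_ x. x = \<zero>)"
  using assms by (auto simp: coord_system_def)

lemma coord_system_gdirect_sum:
  assumes K: "finite K" and M: "\<And>k. k \<in> K \<Longrightarrow> coord_system C b (M k) i (S k) (T k) (Z k)"
  shows "coord_system C b (gdirect_sum K M) i (Sigma K S) (Sigma K T) (\<lambda>(k, s) x. Z k s (x k))"
    (is "coord_system C b ?M i ?S ?T ?Z")
proof
  have homog: "homog ?M i = (\<Pi>\<^sub>E k\<in>K. homog (M k) i)"
    by (simp add: gdirect_sum_def)
  show "finite ?S" "?T \<subseteq> ?S"
    using K coord_system.finite[OF M] coord_system.subset[OF M] by auto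
  show "\<zero>\<^bsub>?M\<^esub> \<in> homog ?M i"
    unfolding homog using coord_system.zero[OF M] by (auto simp: gdirect_sum_def)
  fix x assume x: "x \<in> homog ?M i"
  then have xk: "x k \<in> homog (M k) i" if "k \<in> K" for k
    using that by (auto simp: homog)
  \<comment> \<open>Members of the product are extensional, so equality with zero can be tested on
    \<open>K\<close> alone.\<close>
  have ext: "x = (\<lambda>k\<in>K. x k)"
    using x unfolding homog by (metis PiE_restrict)
  have "x = \<zero>\<^bsub>?M\<^esub> \<longleftrightarrow> (\<forall>k\<in>K. x k = \<zero>\<^bsub>M k\<^esub>)"
    by (subst ext) (auto simp: gdirect_sum_def fun_eq_iff)
  then show "x = \<zero>\<^bsub>?M\<^esub> \<longleftrightarrow> (\<forall>s\<in>?S. ?Z s x)"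
    using coord_system.zero_iff[OF M xk] by auto
  have "b \<odot>\<^bsub>?M\<^esub> x = \<zero>\<^bsub>?M\<^esub> \<longleftrightarrow> (\<forall>k\<in>K. b \<odot>\<^bsub>M k\<^esub> x k = \<zero>\<^bsub>M k\<^esub>)"
    by (auto simp: gdirect_sum_def fun_eq_iff)
  then show "b \<odot>\<^bsub>?M\<^esub> x = \<zero>\<^bsub>?M\<^esub> \<longleftrightarrow> (\<forall>s\<in>?T. ?Z s x)"
    using coord_system.power_iff[OF M xk] by auto
  fix s assume s: "s \<in> ?S"
  {
    fix c assume "c \<in> C" "?Z s x"
    then show "?Z s (c \<odot>\<^bsub>?M\<^esub> x)"
      using s xk coord_system.smult[OF M] by (auto simp: gdirect_sum_def)
  }
  fix y assume y: "y \<in> homog ?M i"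
  then have yk: "y k \<in> homog (M k) i" if "k \<in> K" for k
    using that by (auto simp: homog)
  assume "?Z s x" "?Z s y"
  then show "?Z s (x \<oplus>\<^bsub>?M\<^esub> y)"
    using s xk yk coord_system.add[OF M] by (auto simp: gdirect_sum_def)
next
  have homog: "homog ?M i = (\<Pi>\<^sub>E k\<in>K. homog (M k) i)"
    by (simp add: gdirect_sum_def)
  fix ks assume "ks \<in> ?S"
  then obtain k s where ks: "ks = (k, s)" "k \<in> K" "s \<in> S k"
    by auto
  obtain e where e: "e \<in> homog (M k) i" "\<not> Z k s e" "\<forall>t\<in>S k - {s}. Z k t e"
    "\<forall>x\<in>homog (M k) i. \<exists>c\<in>C. Z k s (x \<oplus>\<^bsub>M k\<^esub> c \<odot>\<^bsub>M k\<^esub> e)"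
    using coord_system.dual[OF M[OF ks(2)] ks(3)] by auto
  \<comment> \<open>The dual element of the summand \<open>k\<close>, extended by zero to the other
    summands.\<close>
  let ?e = "\<lambda>k'\<in>K. if k' = k then e else \<zero>\<^bsub>M k'\<^esub>"
  have "?e \<in> homog ?M i"
    using e(1) coord_system.zero[OF M] by (auto simp: homog)
  moreover have "\<not> ?Z ks ?e"
    using ks e by simp
  moreover have "?Z t ?e" if t: "t \<in> ?S - {ks}" for t
  proof -
    have "Z k' s' \<zero>\<^bsub>M k'\<^esub>" if "k' \<in> K" "s' \<in> S k'" for k' s'
      using coord_system.zero_iff[OF M[OF that(1)] coord_system.zero[OF M[OF that(1)]]] that by auto
    moreover obtain k' s' where "t = (k', s')" "k' \<in> K" "s' \<in> S k'" "k' = k \<longrightarrow> s' \<noteq> s"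
      using t ks by (cases t) auto
    ultimately show ?thesis
      using e(3) by (cases "k' = k") auto
  qed
  moreover have "\<exists>c\<in>C. ?Z ks (x \<oplus>\<^bsub>?M\<^esub> c \<odot>\<^bsub>?M\<^esub> ?e)" if "x \<in> homog ?M i" for x
  proof -
    have "x k \<in> homog (M k) i"
      using that ks(2) by (auto simp: homog)
    then show ?thesis
      using e(4) ks by (simp add: gdirect_sum_def)
  qed
  ultimately show "\<exists>e\<in>homog ?M i. \<not> ?Z ks e \<and> (\<forall>t\<in>?S - {ks}. ?Z t e) \<and>
      (\<forall>x\<in>homog ?M i. \<exists>c\<in>C. ?Z ks (x \<oplus>\<^bsub>?M\<^esub> c \<odot>\<^bsub>?M\<^esub> e))"
    by (intro bexI[of _ ?e]) blast+
qed

lemma coord_system_gcopies: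
  assumes "coord_system C b M i S T Z"
  shows "coord_system C b (gcopies M n) i ({..<n} \<times> S) ({..<n} \<times> T) (\<lambda>(k, s) x. Z s (x k))"
  unfolding gcopies_def by (rule coord_system_gdirect_sum) (simp_all add: assms)

lemma coord_system_gdirect_sum2:
  assumes M: "coord_system C b M i S T Z" and M': "coord_system C b M' i S' T' Z'"
  shows "coord_system C b (gdirect_sum2 M M') i (Sum_Type.Plus S S') (Sum_Type.Plus T T')
    (case_sum (\<lambda>s x. Z s (fst x)) (\<lambda>s x. Z' s (snd x)))"
    (is "coord_system C b ?M i ?S ?T ?Z")
proof -
  interpret M: coord_system C b M i S T Z
    by (rule M)
  interpret M': coord_system C b M' i S' T' Z'
    by (rule M')
  have ball: "(\<forall>s\<in>Sum_Type.Plus X Y. P s) \<longleftrightarrow> (\<forall>s\<in>X. P (Inl s)) \<and> (\<forall>s\<in>Y. P (Inr s))" for X Y P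
    by auto
  show ?thesis
  proof
    show "finite ?S" "?T \<subseteq> ?S" "\<zero>\<^bsub>?M\<^esub> \<in> homog ?M i"
      using M.finite M'.finite M.subset M'.subset M.zero M'.zero by (auto simp: gdirect_sum2_def)
    fix x assume x: "x \<in> homog ?M i"
    show "x = \<zero>\<^bsub>?M\<^esub> \<longleftrightarrow> (\<forall>s\<in>?S. ?Z s x)"
      using x M.zero_iff[of "fst x"] M'.zero_iff[of "snd x"]
      by (simp add: gdirect_sum2_def prod_eq_iff ball mem_Times_iff)
    show "b \<odot>\<^bsub>?M\<^esub> x = \<zero>\<^bsub>?M\<^esub> \<longleftrightarrow> (\<forall>s\<in>?T. ?Z s x)"
      using x M.power_iff[of "fst x"] M'.power_iff[of "snd x"]
      by (simp add: gdirect_sum2_def ball mem_Times_iff)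
    fix s assume s: "s \<in> ?S"
    {
      fix c assume "c \<in> C" "?Z s x"
      then show "?Z s (c \<odot>\<^bsub>?M\<^esub> x)"
        using s x M.smult M'.smult by (auto simp: gdirect_sum2_def)
    }
    fix y assume "y \<in> homog ?M i" "?Z s x" "?Z s y"
    then show "?Z s (x \<oplus>\<^bsub>?M\<^esub> y)"
      using s x M.add M'.add by (auto simp: gdirect_sum2_def)
  next
    fix s assume "s \<in> ?S"
    then consider (l) s1 where "s = Inl s1" "s1 \<in> S" | (r) s2 where "s = Inr s2" "s2 \<in> S'"
      by auto
    then show "\<exists>e\<in>homog ?M i. \<not> ?Z s e \<and> (\<forall>t\<in>?S - {s}. ?Z t e) \<and>
        (\<forall>x\<in>homog ?M i. \<exists>c\<in>C. ?Z s (x \<oplus>\<^bsub>?M\<^esub> c \<odot>\<^bsub>?M\<^esub> e))"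
    proof cases
      case l
      obtain e where e: "e \<in> homog M i" "\<not> Z s1 e" "\<forall>t\<in>S - {s1}. Z t e"
        "\<forall>x\<in>homog M i. \<exists>c\<in>C. Z s1 (x \<oplus>\<^bsub>M\<^esub> c \<odot>\<^bsub>M\<^esub> e)"
        using M.dual[OF l(2)] by auto
      show ?thesis
        using l e M'.zero M'.zero_iff[OF M'.zero]
        by (intro bexI[of _ "(e, \<zero>\<^bsub>M'\<^esub>)"]) (auto simp: gdirect_sum2_def)
    next
      case r
      obtain e where e: "e \<in> homog M' i" "\<not> Z' s2 e" "\<forall>t\<in>S' - {s2}. Z' t e"
        "\<forall>x\<in>homog M' i. \<exists>c\<in>C. Z' s2 (x \<oplus>\<^bsub>M'\<^esub> c \<odot>\<^bsub>M'\<^esub> e)"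
        using M'.dual[OF r(2)] by auto
      show ?thesis
        using r e M.zero M.zero_iff[OF M.zero]
        by (intro bexI[of _ "(\<zero>\<^bsub>M\<^esub>, e)"]) (auto simp: gdirect_sum2_def)
    qed
  qed
qed

section \<open>The fiber cone of a principal ideal\<close>

text \<open>That \<open>a\<close> is not nilpotent makes every graded piece a line over the residue
  field, spanned by the class of a power of \<open>a\<close>; this is the form in which it is used
  that the fiber cone is a polynomial ring in one variable.\<close>

locale principal_fiber = fiber +
  fixes a :: 'a
  assumes a: "a \<in> carrier R" and L_eq: "L = PIdl a" and not_nilpotent: "a [^] (n::nat) \<noteq> \<zero>"
begin

lemma P_eq: "P n = {c \<otimes> a [^] n | c. c \<in> carrier R}"
proof (induct n)
  case 0
  show ?case
  proof -
    have "c \<in> {c \<otimes> a [^] (0::nat) | c. c \<in> carrier R}" if "c \<in> carrier R" for c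
      using that by (intro CollectI exI[of _ c]) simp
    then show ?thesis
      unfolding ideal_pow_0 by auto
  qed
next
  case (Suc n)
  have "P (Suc n) = (PIdl (a [^] n)) \<cdot> (PIdl a)"
    unfolding ideal_pow_Suc Suc by (simp only: cgenideal_def L_eq)
  also have "\<dots> = PIdl (a [^] Suc n)"
  proof
    show "(PIdl (a [^] n)) \<cdot> (PIdl a) \<subseteq> PIdl (a [^] Suc n)"
    proof
      fix s assume "s \<in> (PIdl (a [^] n)) \<cdot> (PIdl a)"
      then show "s \<in> PIdl (a [^] Suc n)"
      proof induct
        case (prod u v)
        then have "u \<otimes> v \<in> (PIdl (a [^] n)) <#> (PIdl a)"
          by (auto simp: set_mult_def)
        then show ?case
          using cgenideal_prod[of "a [^] n" a] a by simp
      next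
        case (sum u v)
        then show ?case
          using ideal_closed(3)[OF cgenideal_ideal] a by simp
      qed
    qed
    have "a [^] Suc n \<in> (PIdl (a [^] n)) \<cdot> (PIdl a)"
      using a cgenideal_self by (simp add: ideal_prod.prod)
    then show "PIdl (a [^] Suc n) \<subseteq> (PIdl (a [^] n)) \<cdot> (PIdl a)"
      using cgenideal_minimal ideal_prod_is_ideal cgenideal_ideal a by simp
  qed
  finally show ?case
    by (simp add: cgenideal_def)
qed

lemma P_0: "P 0 = carrier R"
  by (rule ideal_pow_0)

lemma power_in_P: "c \<in> carrier R \<Longrightarrow> c \<otimes> a [^] n \<in> P n"
  unfolding P_eq by auto

lemma power_in_P': "a [^] n \<in> P n"
  using power_in_P[of \<one> n] a by simp

text \<open>Every element of \<open>Q n\<close> is \<open>d a^n\<close> with \<open>d\<close> in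
  \<open>\<mm>\<close>. If \<open>c a^n = d a^n\<close> with \<open>c\<close> outside
  \<open>\<mm>\<close>, then the unit \<open>c - d\<close> annihilates \<open>a^n\<close>, which is
  nonzero. No cancellation of \<open>a\<close> occurs.\<close>

lemma in_Q_iff:
  assumes c: "c \<in> carrier R"
  shows "c \<otimes> a [^] n \<in> Q n \<longleftrightarrow> c \<in> \<mm>"
proof
  assume "c \<in> \<mm>"
  then show "c \<otimes> a [^] n \<in> Q n"
    using power_in_P' by (rule ideal_prod.prod)
next
  have pow: "a [^] n \<in> carrier R"
    using a by simp
  have "\<exists>d\<in>\<mm>. s = d \<otimes> a [^] n" if "s \<in> Q n" for s
    using that
  proof induct
    case (prod u v)
    then obtain d where d: "d \<in> carrier R" "v = d \<otimes> a [^] n"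
      unfolding P_eq by auto
    have u: "u \<in> carrier R"
      using prod(1) ideal_closed(2)[OF \<mm>_ideal] by auto
    have "u \<otimes> v = (d \<otimes> u) \<otimes> a [^] n"
      using d u pow by (simp add: m_ac)
    then show ?case
      using ideal_closed(5)[OF \<mm>_ideal d(1) prod(1)] by blast
  next
    case (sum u v)
    then obtain d g where "d \<in> \<mm>" "u = d \<otimes> a [^] n" "g \<in> \<mm>" "v = g \<otimes> a [^] n"
      by auto
    then have "u \<oplus> v = (d \<oplus> g) \<otimes> a [^] n" "d \<oplus> g \<in> \<mm>"
      using pow ideal_closed(2,3)[OF \<mm>_ideal] by (auto simp: l_distr subset_iff)
    then show ?case
      by blast
  qed
  moreover assume "c \<otimes> a [^] n \<in> Q n"
  ultimately obtain d where d: "d \<in> \<mm>" "c \<otimes> a [^] n = d \<otimes> a [^] n"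
    by blast
  have dc: "d \<in> carrier R"
    using d(1) ideal_closed(2)[OF \<mm>_ideal] by auto
  show "c \<in> \<mm>"
  proof (rule ccontr)
    assume nc: "c \<notin> \<mm>"
    have "c \<ominus> d \<notin> \<mm>"
    proof
      assume "c \<ominus> d \<in> \<mm>"
      then have "(c \<ominus> d) \<oplus> d \<in> \<mm>"
        using d(1) ideal_closed(3)[OF \<mm>_ideal] by blast
      then show False
        using nc c dc by (simp add: a_minus_def a_assoc l_neg)
    qed
    then obtain g where g: "g \<in> carrier R" "g \<otimes> (c \<ominus> d) = \<one>"
      using unit_outside_\<mm>[of "c \<ominus> d"] c dc by auto
    have "a [^] n = (g \<otimes> (c \<ominus> d)) \<otimes> a [^] n"
      using g pow by simp
    also have "\<dots> = g \<otimes> (c \<otimes> a [^] n \<ominus> d \<otimes> a [^] n)"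
      using g(1) c dc pow by algebra
    also have "\<dots> = \<zero>"
      using d(2) g(1) dc pow by (simp add: a_minus_def r_neg)
    finally show False
      using not_nilpotent by simp
  qed
qed

text \<open>The degree zero part of the fiber cone, a copy of the residue field. Its elements act
  within a single degree, which is why coordinates are compared up to these.\<close>

definition scalars :: "(nat \<Rightarrow> 'a set) set" where
  "scalars = cls 0 ` carrier R"

abbreviation pow :: "nat \<Rightarrow> nat \<Rightarrow> 'a set" where
  "pow l \<equiv> cls l (a [^] l)"

lemma cls_0_mult:
  assumes "c \<in> carrier R" "u \<in> P n"
  shows "cls 0 c \<otimes>\<^bsub>F\<^esub> cls n u = cls n (c \<otimes> u)"
  using cls_mult[of c 0 u n, unfolded P_0] assms by simp

lemma pow_mult:
  assumes "c \<in> carrier R"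
  shows "pow l \<otimes>\<^bsub>F\<^esub> cls n (c \<otimes> a [^] n) = cls (l + n) (c \<otimes> a [^] (l + n))"
proof -
  have "a [^] l \<otimes> (c \<otimes> a [^] n) = c \<otimes> a [^] (l + n)"
    using a assms by (simp add: m_ac nat_pow_mult[symmetric])
  then show ?thesis
    using cls_mult[OF power_in_P' power_in_P[OF assms]] by simp
qed

lemma cls_power_zero_iff:
  assumes "c \<in> carrier R"
  shows "cls n (c \<otimes> a [^] n) = \<zero>\<^bsub>F\<^esub> \<longleftrightarrow> c \<in> \<mm>"
  using cls_zero_iff[OF power_in_P[OF assms]] in_Q_iff[OF assms] by simp

lemma smult_self:
  assumes "u \<in> P n"
  shows "cls n u \<odot>\<^bsub>fiber_gmodule R \<mm> L\<^esub> x = cls n u \<otimes>\<^bsub>F\<^esub> x"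
  using incl_cls[OF order_refl L assms] by (simp add: fiber_gmodule_def Let_def)

lemma cls_negate:
  assumes "c \<in> carrier R"
  shows "cls n (c \<otimes> a [^] n) \<oplus>\<^bsub>F\<^esub> cls n (\<ominus> c \<otimes> a [^] n) = \<zero>\<^bsub>F\<^esub>"
proof -
  have "c \<otimes> a [^] n \<oplus> \<ominus> c \<otimes> a [^] n = \<zero>"
    using assms a by (simp add: l_distr[symmetric] r_neg)
  then show ?thesis
    using cls_add[OF power_in_P[OF assms] power_in_P[of "\<ominus> c"]] assms by (simp add: cls_zero)
qed

lemma degree_power: "fiber_degree R \<mm> L n = {cls n (c \<otimes> a [^] n) | c. c \<in> carrier R}"
  unfolding degree_eq P_eq by auto

lemma mult_zero:
  assumes "u \<in> P n"
  shows "cls n u \<otimes>\<^bsub>F\<^esub> \<zero>\<^bsub>F\<^esub> = \<zero>\<^bsub>F\<^esub>"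
  using cls_mult[OF assms ideal_closed(1)[OF P_ideal], of 0] P_carrier[OF assms]
  by (simp add: cls_zero)

text \<open>In degree \<open>i\<close> the shifted module is the line of classes
  \<open>c a^(i-k)\<close> if \<open>k \<le> i\<close>, and zero otherwise. Multiplication by
  \<open>a^l\<close> keeps \<open>c\<close> and only raises the exponent, and vanishing means
  \<open>c \<in> \<mm>\<close> in each degree, so it is injective.\<close>

lemma coord_system_free:
  "coord_system scalars (pow l) (gshift k (fiber_gmodule R \<mm> L)) i
     (if k \<le> i then {()} else {}) (if k \<le> i then {()} else {})
     (\<lambda>_ x. x = \<zero>\<^bsub>F\<^esub>)"
proof -
  let ?M = "gshift k (fiber_gmodule R \<mm> L)"
  have M: "\<zero>\<^bsub>?M\<^esub> = \<zero>\<^bsub>F\<^esub>" "add ?M = add F"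
    "\<And>n u x. u \<in> P n \<Longrightarrow> cls n u \<odot>\<^bsub>?M\<^esub> x = cls n u \<otimes>\<^bsub>F\<^esub> x"
    "homog ?M i = (if i < k then {\<zero>\<^bsub>F\<^esub>} else fiber_degree R \<mm> L (i - k))"
    using smult_self by (simp_all add: gshift_def fiber_gmodule_def Let_def)
  have C: "c \<in> scalars \<longleftrightarrow> (\<exists>d\<in>P 0. c = cls 0 d)" for c
    unfolding scalars_def P_0 by auto
  show ?thesis
  proof (cases "k \<le> i")
    case True
    let ?n = "i - k"
    have homog: "homog ?M i = {cls ?n (c \<otimes> a [^] ?n) | c. c \<in> carrier R}"
      using True by (simp add: M degree_power)
    have "coord_system scalars (pow l) ?M i {()} (if True then {()} else {}) (\<lambda>_ x. x = \<zero>\<^bsub>?M\<^esub>)"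
    proof (rule coord_system_line)
      show "\<zero>\<^bsub>?M\<^esub> \<in> homog ?M i"
      proof -
        have "\<zero>\<^bsub>F\<^esub> = cls ?n (\<zero> \<otimes> a [^] ?n)"
          using cls_power_zero_iff[OF zero_closed, of ?n] ideal_closed(1)[OF \<mm>_ideal] by simp
        then show ?thesis
          unfolding homog M(1) using zero_closed by blast
      qed
      show "\<zero>\<^bsub>?M\<^esub> \<oplus>\<^bsub>?M\<^esub> \<zero>\<^bsub>?M\<^esub> = \<zero>\<^bsub>?M\<^esub>"
        using abelian_group.axioms(1)[OF F_group, THEN abelian_monoid.l_zero]
          abelian_group.axioms(1)[OF F_group, THEN abelian_monoid.zero_closed] by (simp add: M)
      show "c \<odot>\<^bsub>?M\<^esub> \<zero>\<^bsub>?M\<^esub> = \<zero>\<^bsub>?M\<^esub>" if "c \<in> scalars" for c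
        using that M mult_zero by (auto simp: C)
      show "cls ?n (\<one> \<otimes> a [^] ?n) \<in> homog ?M i"
        unfolding homog by auto
      show "cls ?n (\<one> \<otimes> a [^] ?n) \<noteq> \<zero>\<^bsub>?M\<^esub>"
        using cls_power_zero_iff[OF one_closed] one_notin_\<mm> by (simp add: M)
      fix x assume "x \<in> homog ?M i"
      then obtain c where c: "c \<in> carrier R" "x = cls ?n (c \<otimes> a [^] ?n)"
        unfolding homog by auto
      have "x \<oplus>\<^bsub>?M\<^esub> cls 0 (\<ominus> c) \<odot>\<^bsub>?M\<^esub> cls ?n (\<one> \<otimes> a [^] ?n) = \<zero>\<^bsub>?M\<^esub>"
        using c a cls_negate cls_0_mult[OF _ power_in_P'] M(3)[of "\<ominus> c" 0, unfolded P_0]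
        by (simp add: M(1,2))
      then show "\<exists>c\<in>scalars. x \<oplus>\<^bsub>?M\<^esub> c \<odot>\<^bsub>?M\<^esub> cls ?n (\<one> \<otimes> a [^] ?n) = \<zero>\<^bsub>?M\<^esub>"
        using c by (intro bexI[of _ "cls 0 (\<ominus> c)"]) (auto simp: scalars_def)
      show "pow l \<odot>\<^bsub>?M\<^esub> x = \<zero>\<^bsub>?M\<^esub> \<longleftrightarrow> (True \<longrightarrow> x = \<zero>\<^bsub>?M\<^esub>)"
        using c pow_mult cls_power_zero_iff power_in_P' by (simp add: M)
    qed
    then show ?thesis
      using True M(1) by simp
  next
    case False
    then have "coord_system scalars (pow l) ?M i {} {} (\<lambda>_ x. x = \<zero>\<^bsub>F\<^esub>)"
      using M mult_zero power_in_P' by (intro coord_system_trivial) auto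
    then show ?thesis
      using False by simp
  qed
qed

text \<open>This will be the ideal \<open>a^j F(L)\<close>. Described by vanishing coefficients, it
  makes congruence the same as agreement in all degrees below \<open>j\<close>.\<close>

definition tail :: "nat \<Rightarrow> (nat \<Rightarrow> 'a set) set" where
  "tail j = {x \<in> carrier F. \<forall>n<j. x n = Q n}"

text \<open>The support of the product lies in the support of \<open>y\<close> moved up by
  \<open>n\<close>, so it stays finite.\<close>

lemma cls_mult_closed:
  assumes u: "u \<in> P n" and y: "y \<in> carrier F"
  shows "cls n u \<otimes>\<^bsub>F\<^esub> y \<in> carrier F"
proof -
  have piece: "y n \<in> (\<lambda>u. Q n +> u) ` P n" for n
    using y by (simp add: F_carrier)
  note eq = cls_mult_left[OF u y]
  have "(cls n u \<otimes>\<^bsub>F\<^esub> y) k \<in> (\<lambda>u. Q k +> u) ` P k" for k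
  proof (cases "k < n")
    case False
    then show ?thesis
      using coset_mult_closed[OF imageI[OF u] piece[of "k - n"]] by (simp add: eq)
  qed (simp add: eq zero_in_piece)
  moreover have sub: "{k. (cls n u \<otimes>\<^bsub>F\<^esub> y) k \<noteq> Q k} \<subseteq> (\<lambda>k. k + n) ` {k. y k \<noteq> Q k}"
  proof
    fix k assume k: "k \<in> {k. (cls n u \<otimes>\<^bsub>F\<^esub> y) k \<noteq> Q k}"
    then have "n \<le> k"
      by (auto simp: eq split: if_splits)
    moreover have "y (k - n) \<noteq> Q (k - n)"
    proof
      assume "y (k - n) = Q (k - n)"
      then have "rcoset_mult R (Q k) (Q n +> u) (y (k - n)) = Q k"
        using coset_mult_zero(1)[OF imageI[OF u], of "k - n"] calculation by simp
      then show False
        using k eq[of k] by (simp split: if_splits)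
    qed
    ultimately show "k \<in> (\<lambda>k. k + n) ` {k. y k \<noteq> Q k}"
      by (intro image_eqI[of _ _ "k - n"]) auto
  qed
  have "finite {k. (cls n u \<otimes>\<^bsub>F\<^esub> y) k \<noteq> Q k}"
    using y by (intro finite_subset[OF sub] finite_imageI) (simp add: F_carrier)
  ultimately show ?thesis
    by (simp add: F_carrier)
qed

text \<open>Principal ideals carry their generator as the right factor, whereas the closure of
  products is known for a homogeneous left factor.\<close>

lemma cls_mult_commute:
  assumes u: "u \<in> P n" and y: "y \<in> carrier F"
  shows "y \<otimes>\<^bsub>F\<^esub> cls n u = cls n u \<otimes>\<^bsub>F\<^esub> y"
proof
  fix k
  show "(y \<otimes>\<^bsub>F\<^esub> cls n u) k = (cls n u \<otimes>\<^bsub>F\<^esub> y) k"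
  proof (cases "k < n")
    case False
    have "y (k - n) \<in> (\<lambda>u. Q (k - n) +> u) ` P (k - n)"
      using y by (simp add: F_carrier)
    then obtain v where v: "v \<in> P (k - n)" "y (k - n) = Q (k - n) +> v"
      by auto
    show ?thesis
      using False v(2) coset_mult[OF u v(1)] coset_mult[OF v(1) u] P_carrier[OF u] P_carrier[OF v(1)]
      by (simp add: cls_mult_left[OF u y] cls_mult_right[OF u y] m_comm)
  qed (simp add: cls_mult_left[OF u y] cls_mult_right[OF u y])
qed

lemma pow_eq: "pow 1 [^]\<^bsub>F\<^esub> (j::nat) = pow j"
proof (induct j)
  case 0
  show ?case
    by (simp add: nat_pow_def fiber_cone_def)
next
  case (Suc j)
  have "pow 1 [^]\<^bsub>F\<^esub> Suc j = pow j \<otimes>\<^bsub>F\<^esub> pow 1"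
    using Suc by (simp add: nat_pow_def)
  also have "\<dots> = cls (j + 1) (a [^] j \<otimes> a [^] (1::nat))"
    using power_in_P' by (rule cls_mult) (rule power_in_P')
  finally show ?case
    using a by simp
qed

lemma fiber_power_ideal_eq: "fiber_power_ideal R \<mm> a j = tail j"
proof -
  have "fiber_power_ideal R \<mm> a j = {s \<otimes>\<^bsub>F\<^esub> pow j | s. s \<in> carrier F}"
    using pow_eq[of j] a unfolding fiber_power_ideal_def Let_def cgenideal_def L_eq by simp
  also have "\<dots> = tail j"
  proof
    have "s \<otimes>\<^bsub>F\<^esub> pow j \<in> tail j" if s: "s \<in> carrier F" for s
      using cls_mult_closed[OF power_in_P' s] cls_mult_commute[OF power_in_P' s]
        cls_mult_left[OF power_in_P' s] by (simp add: tail_def)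
    then show "{s \<otimes>\<^bsub>F\<^esub> pow j | s. s \<in> carrier F} \<subseteq> tail j"
      by auto
    show "tail j \<subseteq> {s \<otimes>\<^bsub>F\<^esub> pow j | s. s \<in> carrier F}"
    proof
      fix x assume x: "x \<in> tail j"
      \<comment> \<open>Division by \<open>a^j\<close> in one degree: \<open>c a^(n+j)\<close> has
        quotient \<open>c a^n\<close>. The last condition selects the zero quotient for a zero
        coefficient and thereby keeps the support of \<open>s\<close> finite.\<close>
      have "\<exists>X \<in> (\<lambda>u. Q n +> u) ` P n.
        rcoset_mult R (Q (n + j)) X (Q j +> a [^] j) = x (n + j) \<and> (x (n + j) = Q (n + j) \<longrightarrow> X = Q n)"
        for n
      proof (cases "x (n + j) = Q (n + j)")
        case True
        then show ?thesis
          using coset_mult_zero(2)[OF imageI[OF power_in_P'[of j]], of n] zero_in_piece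
          by (intro bexI[of _ "Q n"]) simp_all
      next
        case False
        have "x (n + j) \<in> (\<lambda>u. Q (n + j) +> u) ` P (n + j)"
          using x unfolding tail_def F_carrier by auto
        then obtain c where c: "c \<in> carrier R" "x (n + j) = Q (n + j) +> (c \<otimes> a [^] (n + j))"
          unfolding P_eq by auto
        have "c \<otimes> a [^] n \<otimes> a [^] j = c \<otimes> a [^] (n + j)"
          using c(1) a by (simp add: m_assoc nat_pow_mult)
        then have "rcoset_mult R (Q (n + j)) (Q n +> (c \<otimes> a [^] n)) (Q j +> a [^] j) = x (n + j)"
          using coset_mult[OF power_in_P[OF c(1)] power_in_P'] c(2) by simp
        then show ?thesis
          using False power_in_P[OF c(1)] by blast
      qed
      then obtain s where s: "\<And>n. s n \<in> (\<lambda>u. Q n +> u) ` P n"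
        "\<And>n. rcoset_mult R (Q (n + j)) (s n) (Q j +> a [^] j) = x (n + j)"
        "\<And>n. x (n + j) = Q (n + j) \<Longrightarrow> s n = Q n"
        by metis
      have sub: "(\<lambda>n. n + j) ` {n. s n \<noteq> Q n} \<subseteq> {n. x n \<noteq> Q n}"
        using s(3) by auto
      have "finite {n. x n \<noteq> Q n}"
        using x by (simp add: tail_def F_carrier)
      from finite_subset[OF sub this] have "finite {n. s n \<noteq> Q n}"
        by (rule finite_imageD) (simp add: inj_on_def)
      then have sF: "s \<in> carrier F"
        using s(1) by (simp add: F_carrier)
      have "x k = (s \<otimes>\<^bsub>F\<^esub> pow j) k" for k
        using s(2)[of "k - j"] x cls_mult_right[OF power_in_P' sF, of j k]
        by (cases "k < j") (simp_all add: tail_def)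
      then have "x = s \<otimes>\<^bsub>F\<^esub> pow j"
        by (intro ext)
      then show "x \<in> {s \<otimes>\<^bsub>F\<^esub> pow j | s. s \<in> carrier F}"
        using sF by blast
    qed
  qed
  finally show ?thesis .
qed

section \<open>Quotients of the fiber cone by powers of the class of \<open>a\<close>\<close>

lemma F_add_coefficient: "(x \<oplus>\<^bsub>F\<^esub> y) n = x n \<oplus>\<^bsub>fiber_piece R \<mm> L n\<^esub> y n"
  by (simp add: fiber_cone_def)

lemma tail_coset:
  assumes x: "x \<in> carrier F"
  shows "tail j +>\<^bsub>F\<^esub> x = {z \<in> carrier F. \<forall>n<j. z n = x n}"
proof -
  interpret F: abelian_group F
    by (rule F_group)
  interpret piece: abelian_group "fiber_piece R \<mm> L n" for n
    by (rule piece_group)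
  have piece: "y n \<in> carrier (fiber_piece R \<mm> L n)" if "y \<in> carrier F" for y n
    using that by (simp add: F_carrier piece_carrier)
  have shift: "(h \<oplus>\<^bsub>F\<^esub> x) n = x n \<longleftrightarrow> h n = Q n" if "h \<in> carrier F" for h n
    using piece.add.r_cancel_one[OF piece[OF x] piece[OF that], of n]
    by (simp add: F_add_coefficient piece_zero)
  show ?thesis
  proof
    show "tail j +>\<^bsub>F\<^esub> x \<subseteq> {z \<in> carrier F. \<forall>n<j. z n = x n}"
      using x shift by (auto simp: a_r_coset_def' tail_def)
    show "{z \<in> carrier F. \<forall>n<j. z n = x n} \<subseteq> tail j +>\<^bsub>F\<^esub> x"
    proof
      fix z assume z: "z \<in> {z \<in> carrier F. \<forall>n<j. z n = x n}"
      then have h: "z \<ominus>\<^bsub>F\<^esub> x \<in> carrier F" and eq: "(z \<ominus>\<^bsub>F\<^esub> x) \<oplus>\<^bsub>F\<^esub> x = z"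
        using x by (simp_all add: F.minus_eq F.a_assoc F.l_neg)
      have "z \<ominus>\<^bsub>F\<^esub> x \<in> tail j"
        using z shift[OF h] unfolding eq by (simp add: tail_def h)
      then show "z \<in> tail j +>\<^bsub>F\<^esub> x"
        unfolding a_r_coset_def' by (intro UN_I[of "z \<ominus>\<^bsub>F\<^esub> x"]) (simp_all add: eq)
    qed
  qed
qed

lemma tail_coset_eq_iff:
  assumes "x \<in> carrier F" "y \<in> carrier F"
  shows "tail j +>\<^bsub>F\<^esub> x = tail j +>\<^bsub>F\<^esub> y \<longleftrightarrow> (\<forall>n<j. x n = y n)"
proof
  assume "tail j +>\<^bsub>F\<^esub> x = tail j +>\<^bsub>F\<^esub> y"
  moreover have "x \<in> tail j +>\<^bsub>F\<^esub> x"
    using tail_coset[OF assms(1)] assms(1) by simp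
  ultimately show "\<forall>n<j. x n = y n"
    using tail_coset[OF assms(2)] by simp
qed (use assms in \<open>simp add: tail_coset\<close>)

lemma tail_eq_coset_zero: "tail j = tail j +>\<^bsub>F\<^esub> \<zero>\<^bsub>F\<^esub>"
proof -
  interpret F: abelian_group F
    by (rule F_group)
  show ?thesis
    by (simp add: tail_coset) (simp add: tail_def F_zero)
qed

lemma tail_coset_add:
  assumes x: "x \<in> carrier F" and y: "y \<in> carrier F"
  shows "(tail j +>\<^bsub>F\<^esub> x) <+>\<^bsub>F\<^esub> (tail j +>\<^bsub>F\<^esub> y) = tail j +>\<^bsub>F\<^esub> (x \<oplus>\<^bsub>F\<^esub> y)"
proof -
  interpret F: abelian_group F
    by (rule F_group)
  show ?thesis
  proof
    show "(tail j +>\<^bsub>F\<^esub> x) <+>\<^bsub>F\<^esub> (tail j +>\<^bsub>F\<^esub> y) \<subseteq> tail j +>\<^bsub>F\<^esub> (x \<oplus>\<^bsub>F\<^esub> y)"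
      using assms by (auto simp: tail_coset set_add_def' F_add_coefficient)
    show "tail j +>\<^bsub>F\<^esub> (x \<oplus>\<^bsub>F\<^esub> y) \<subseteq> (tail j +>\<^bsub>F\<^esub> x) <+>\<^bsub>F\<^esub> (tail j +>\<^bsub>F\<^esub> y)"
    proof
      fix z assume "z \<in> tail j +>\<^bsub>F\<^esub> (x \<oplus>\<^bsub>F\<^esub> y)"
      then obtain h where h: "h \<in> tail j" "z = h \<oplus>\<^bsub>F\<^esub> (x \<oplus>\<^bsub>F\<^esub> y)"
        by (auto simp: a_r_coset_def')
      have "h \<in> carrier F"
        using h(1) by (simp add: tail_def)
      then have "z = (h \<oplus>\<^bsub>F\<^esub> x) \<oplus>\<^bsub>F\<^esub> y"
        using h(2) x y by (simp add: F.a_assoc)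
      moreover have "h \<oplus>\<^bsub>F\<^esub> x \<in> tail j +>\<^bsub>F\<^esub> x"
        using h(1) by (auto simp: a_r_coset_def')
      moreover have "y \<in> tail j +>\<^bsub>F\<^esub> y"
        using y by (simp add: tail_coset)
      ultimately show "z \<in> (tail j +>\<^bsub>F\<^esub> x) <+>\<^bsub>F\<^esub> (tail j +>\<^bsub>F\<^esub> y)"
        unfolding set_add_def' by blast
    qed
  qed
qed

text \<open>Representatives of a coset agree below degree \<open>j\<close>, and the coefficients of
  the product below \<open>j\<close> depend only on these. So all cosets in the union are
  equal.\<close>

lemma tail_coset_smult:
  assumes u: "u \<in> P n" and y: "y \<in> carrier F"
  shows "(\<Union>x\<in>tail j +>\<^bsub>F\<^esub> y. tail j +>\<^bsub>F\<^esub> (cls n u \<otimes>\<^bsub>F\<^esub> x)) = tail j +>\<^bsub>F\<^esub> (cls n u \<otimes>\<^bsub>F\<^esub> y)"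
proof (rule SUP_eq_const)
  show "tail j +>\<^bsub>F\<^esub> y \<noteq> {}"
    using y tail_coset[OF y] by blast
  fix x assume "x \<in> tail j +>\<^bsub>F\<^esub> y"
  then have x: "x \<in> carrier F" "\<forall>k<j. x k = y k"
    using tail_coset[OF y] by auto
  show "tail j +>\<^bsub>F\<^esub> (cls n u \<otimes>\<^bsub>F\<^esub> x) = tail j +>\<^bsub>F\<^esub> (cls n u \<otimes>\<^bsub>F\<^esub> y)"
    using x(2) cls_mult_left[OF u x(1)] cls_mult_left[OF u y]
    by (simp add: tail_coset_eq_iff[OF cls_mult_closed[OF u x(1)] cls_mult_closed[OF u y]])
qed

lemma tail_coset_cls_zero_iff:
  assumes "c \<in> carrier R"
  shows "tail j +>\<^bsub>F\<^esub> cls n (c \<otimes> a [^] n) = tail j \<longleftrightarrow> j \<le> n \<or> c \<in> \<mm>"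
proof -
  have "cls n (c \<otimes> a [^] n) n = Q n \<longleftrightarrow> c \<in> \<mm>"
    using coset_zero_iff[OF Q_ideal P_carrier[OF power_in_P]] in_Q_iff assms by (simp add: cls_eq)
  then have "(\<forall>k<j. cls n (c \<otimes> a [^] n) k = \<zero>\<^bsub>F\<^esub> k) \<longleftrightarrow> j \<le> n \<or> c \<in> \<mm>"
    by (metis F_zero cls_eq not_le)
  moreover have "\<zero>\<^bsub>F\<^esub> \<in> carrier F"
    using abelian_group.axioms(1)[OF F_group] by (rule abelian_monoid.zero_closed)
  ultimately show ?thesis
    using tail_coset_eq_iff[OF cls_carrier[OF power_in_P[OF assms]], of "\<zero>\<^bsub>F\<^esub>" j n]
    unfolding tail_eq_coset_zero[symmetric] by blast
qed

text \<open>The quotient shifted by \<open>k\<close> is a line in the degrees from \<open>k\<close>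
  to \<open>k + j - 1\<close> and zero elsewhere. The hypothesis says that \<open>a^l\<close> moves
  degree \<open>i\<close> to \<open>k + j\<close> or beyond, so it kills the component and
  \<open>T\<close> is empty.\<close>

lemma coord_system_torsion:
  assumes l: "j + k \<le> l + i"
  shows "coord_system scalars (pow l)
     (gshift k (fiber_quotient R \<mm> L (fiber_power_ideal R \<mm> a j))) i
     (if k \<le> i \<and> i < k + j then {()} else {}) {} (\<lambda>_ x. x = tail j)"
proof -
  interpret F: abelian_group F
    by (rule F_group)
  let ?M = "gshift k (fiber_quotient R \<mm> L (fiber_power_ideal R \<mm> a j))"
  have M: "\<zero>\<^bsub>?M\<^esub> = tail j" "add ?M = set_add F"
    "\<And>n u x. u \<in> P n \<Longrightarrow> x \<in> carrier F \<Longrightarrow>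
      cls n u \<odot>\<^bsub>?M\<^esub> (tail j +>\<^bsub>F\<^esub> x) = tail j +>\<^bsub>F\<^esub> (cls n u \<otimes>\<^bsub>F\<^esub> x)"
    "homog ?M i = (if i < k then {tail j} else
      (\<lambda>x. tail j +>\<^bsub>F\<^esub> x) ` fiber_degree R \<mm> L (i - k))"
    using tail_coset_smult
    by (simp_all add: gshift_def fiber_quotient_def subquotient_def Let_def fiber_power_ideal_eq)
  have C: "\<exists>d\<in>P 0. c = cls 0 d" if "c \<in> scalars" for c
    using that unfolding scalars_def P_0 by auto
  have smult_zero: "cls n u \<odot>\<^bsub>?M\<^esub> tail j = tail j" if "u \<in> P n" for n u
    using M(3)[OF that F.zero_closed] mult_zero[OF that] by (simp add: tail_eq_coset_zero[symmetric])
  have cl: "cls n (c \<otimes> a [^] n) \<in> carrier F" if "c \<in> carrier R" for n c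
    using cls_carrier[OF power_in_P[OF that]] .
  let ?n = "i - k"
  have homog: "homog ?M i = {tail j +>\<^bsub>F\<^esub> cls ?n (c \<otimes> a [^] ?n) | c. c \<in> carrier R}" if "k \<le> i"
    using that by (auto simp: M(4) degree_power)
  show ?thesis
  proof (cases "k \<le> i \<and> i < k + j")
    case True
    have "coord_system scalars (pow l) ?M i {()} (if False then {()} else {}) (\<lambda>_ x. x = \<zero>\<^bsub>?M\<^esub>)"
    proof (rule coord_system_line)
      have "tail j = tail j +>\<^bsub>F\<^esub> cls ?n (\<zero> \<otimes> a [^] ?n)"
        using tail_coset_cls_zero_iff[OF zero_closed, of j ?n] ideal_closed(1)[OF \<mm>_ideal] by simp
      then show "\<zero>\<^bsub>?M\<^esub> \<in> homog ?M i"
        unfolding homog[OF conjunct1[OF True]] M(1) using zero_closed by blast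
      show "\<zero>\<^bsub>?M\<^esub> \<oplus>\<^bsub>?M\<^esub> \<zero>\<^bsub>?M\<^esub> = \<zero>\<^bsub>?M\<^esub>"
        using tail_coset_add[OF F.zero_closed F.zero_closed, of j]
        by (simp add: M(1,2) tail_eq_coset_zero[symmetric])
      show "c \<odot>\<^bsub>?M\<^esub> \<zero>\<^bsub>?M\<^esub> = \<zero>\<^bsub>?M\<^esub>" if "c \<in> scalars" for c
        using C[OF that] M(1) smult_zero by auto
      show "tail j +>\<^bsub>F\<^esub> cls ?n (\<one> \<otimes> a [^] ?n) \<in> homog ?M i"
        unfolding homog[OF conjunct1[OF True]] by auto
      show "tail j +>\<^bsub>F\<^esub> cls ?n (\<one> \<otimes> a [^] ?n) \<noteq> \<zero>\<^bsub>?M\<^esub>"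
        using tail_coset_cls_zero_iff[OF one_closed, of j ?n] one_notin_\<mm> True
        unfolding M(1) by linarith
      fix x assume "x \<in> homog ?M i"
      then obtain c where c: "c \<in> carrier R" "x = tail j +>\<^bsub>F\<^esub> cls ?n (c \<otimes> a [^] ?n)"
        unfolding homog[OF conjunct1[OF True]] by auto
      have one: "\<one> \<otimes> a [^] ?n = a [^] ?n"
        using a by simp
      have "cls 0 (\<ominus> c) \<odot>\<^bsub>?M\<^esub> (tail j +>\<^bsub>F\<^esub> cls ?n (\<one> \<otimes> a [^] ?n))
          = tail j +>\<^bsub>F\<^esub> cls ?n (\<ominus> c \<otimes> a [^] ?n)"
        using M(3)[of "\<ominus> c" 0, unfolded P_0, OF _ cl[OF one_closed, of ?n]] c(1)
          cls_0_mult[OF _ power_in_P', of "\<ominus> c"] unfolding one by simp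
      then have "x \<oplus>\<^bsub>?M\<^esub> cls 0 (\<ominus> c) \<odot>\<^bsub>?M\<^esub> (tail j +>\<^bsub>F\<^esub> cls ?n (\<one> \<otimes> a [^] ?n)) = \<zero>\<^bsub>?M\<^esub>"
        using c(1) tail_coset_add[OF cl[OF c(1)] cl[of "\<ominus> c"]] cls_negate[OF c(1)]
        by (simp add: M(1,2) c(2) tail_eq_coset_zero[symmetric])
      then show "\<exists>c\<in>scalars. x \<oplus>\<^bsub>?M\<^esub> c \<odot>\<^bsub>?M\<^esub> (tail j +>\<^bsub>F\<^esub> cls ?n (\<one> \<otimes> a [^] ?n)) = \<zero>\<^bsub>?M\<^esub>"
        using c by (intro bexI[of _ "cls 0 (\<ominus> c)"]) (auto simp: scalars_def)
      \<comment> \<open>Here \<open>k \<le> i\<close> ensures that \<open>?n = i - k\<close> is not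
        truncated.\<close>
      have power_large: "j \<le> l + ?n"
        using True l by linarith
      have "pow l \<odot>\<^bsub>?M\<^esub> x = tail j +>\<^bsub>F\<^esub> cls (l + ?n) (c \<otimes> a [^] (l + ?n))"
        using M(3)[OF power_in_P' cl[OF c(1)]] pow_mult[OF c(1)] c(2) by simp
      then show "pow l \<odot>\<^bsub>?M\<^esub> x = \<zero>\<^bsub>?M\<^esub> \<longleftrightarrow> (False \<longrightarrow> x = \<zero>\<^bsub>?M\<^esub>)"
        using tail_coset_cls_zero_iff[OF c(1), of j "l + ?n"] power_large by (simp add: M(1))
    qed
    then show ?thesis
      using True M(1) by simp
  next
    case False
    have "homog ?M i = {tail j}"
    proof (cases "k \<le> i")
      case True
      then have "tail j +>\<^bsub>F\<^esub> cls ?n (c \<otimes> a [^] ?n) = tail j" if "c \<in> carrier R" for c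
        using False tail_coset_cls_zero_iff[OF that, of j ?n] by auto
      then show ?thesis
        unfolding homog[OF True] using one_closed by blast
    qed (simp add: M(4))
    then have "coord_system scalars (pow l) ?M i {} {} (\<lambda>_ x. x = tail j)"
      using M(1) smult_zero[OF power_in_P'] by (intro coord_system_trivial) auto
    then show ?thesis
      by (simp only: False if_False)
  qed
qed

end

section \<open>Invariants of the fiber cone read off from coordinates\<close>

text \<open>Coordinates of \<open>D\<close> in degree \<open>i\<close> are pulled back to the ideal
  \<open>I^i\<close> along \<open>u \<mapsto> \<phi> (cls i u)\<close>, where their kernels are
  ideals of the ring. All coordinates vanish exactly on \<open>\<mm> I^i\<close>, and those in
  \<open>T\<close> exactly where \<open>a^l u\<close> lies in \<open>\<mm> I^(i+l)\<close>. This
  gives a dual basis whose common kernels are the ideals in the two invariants.\<close>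

lemma (in principal_fiber) invariants_from_coordinates:
  fixes D :: "(nat \<Rightarrow> 'a set, 'x) gmodule" and \<phi> :: "(nat \<Rightarrow> 'a set) \<Rightarrow> 'x"
  assumes I: "ideal I R" "L \<subseteq> I"
    and D: "coord_system scalars (pow l) D i S T Z"
    and inj: "inj_on \<phi> (carrier (fiber_cone R \<mm> I))"
    and add: "\<And>x y. x \<in> carrier (fiber_cone R \<mm> I) \<Longrightarrow> y \<in> carrier (fiber_cone R \<mm> I) \<Longrightarrow>
      \<phi> (x \<oplus>\<^bsub>fiber_cone R \<mm> I\<^esub> y) = \<phi> x \<oplus>\<^bsub>D\<^esub> \<phi> y"
    and smult: "\<And>c x. c \<in> carrier F \<Longrightarrow> x \<in> carrier (fiber_cone R \<mm> I) \<Longrightarrow>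
      \<phi> (fiber_incl R \<mm> I c \<otimes>\<^bsub>fiber_cone R \<mm> I\<^esub> x) = c \<odot>\<^bsub>D\<^esub> \<phi> x"
    and degree: "\<And>n. \<phi> ` fiber_degree R \<mm> I n = homog D n"
  shows "min_num_gens R (ideal_pow R I i) = card S"
    and "module_length R (subquotient R
      (ideal_pow R I i \<inter> colon R (\<mm> \<cdot> ideal_pow R I (i + l)) (a [^] l))
      (\<mm> \<cdot> ideal_pow R I i)) = enat (card (S - T))"
proof -
  interpret I: fiber R \<mm> I
    by (intro fiber.intro fiber_axioms.intro noetherian_local_ring_axioms I(1))
  interpret D: coord_system scalars "pow l" D i S T Z
    by (rule D)
  define v where "v u = \<phi> (I.cls i u)" for u
  note Nc = ideal_closed[OF I.P_ideal[of i]]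
  have pow_mem: "u \<in> I.P n" if "u \<in> P n" for u n
    using that ideal_pow_mono[OF I(2)] by auto
  have v_smult: "\<phi> (I.cls (n + i) (c \<otimes> u)) = cls n c \<odot>\<^bsub>D\<^esub> v u" if "c \<in> P n" "u \<in> I.P i" for n c u
    using smult[OF cls_carrier[OF that(1)] I.cls_carrier[OF that(2)]] I.incl_cls[OF I(2) L that(1)]
      I.cls_mult[OF pow_mem[OF that(1)] that(2)] by (simp add: v_def)
  have v_scalar: "v (c \<otimes> u) = cls 0 c \<odot>\<^bsub>D\<^esub> v u" if "c \<in> carrier R" "u \<in> I.P i" for c u
    using v_smult[of c 0 u, unfolded P_0, OF that] by (simp add: v_def)
  have v_add: "v (u \<oplus> w) = v u \<oplus>\<^bsub>D\<^esub> v w" if "u \<in> I.P i" "w \<in> I.P i" for u w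
    using add[OF I.cls_carrier[OF that(1)] I.cls_carrier[OF that(2)]] I.cls_add[OF that]
    by (simp add: v_def)
  have homog: "homog D i = v ` I.P i"
    using degree[of i] unfolding I.degree_eq v_def by (simp add: image_image)
  then have v_mem: "v u \<in> homog D i" if "u \<in> I.P i" for u
    using that by simp
  have Z_zero: "Z s \<zero>\<^bsub>D\<^esub>" if "s \<in> S" for s
    using D.zero_iff[OF D.zero] that by simp
  have scalar: "cls 0 c \<in> scalars" if "c \<in> carrier R" for c
    using that by (simp add: scalars_def)
  \<comment> \<open>No group laws of \<open>D\<close> are at hand, so additivity alone does not give
    this. Instead zero is \<open>v u\<close> for some \<open>u\<close> by surjectivity, and
    multiplying by the scalar zero keeps all coordinates zero.\<close>
  have v_0: "v \<zero> = \<zero>\<^bsub>D\<^esub>"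
  proof -
    obtain u where u: "u \<in> I.P i" "v u = \<zero>\<^bsub>D\<^esub>"
      using D.zero homog by (metis imageE)
    have "v \<zero> = cls 0 \<zero> \<odot>\<^bsub>D\<^esub> \<zero>\<^bsub>D\<^esub>"
      using v_scalar[OF zero_closed u(1)] u(2) I.P_carrier[OF u(1)] by simp
    then have "Z s (v \<zero>)" if "s \<in> S" for s
      using D.smult[OF that scalar[OF zero_closed] D.zero Z_zero[OF that]] by simp
    then show ?thesis
      using D.zero_iff[OF v_mem[OF Nc(1)]] by simp
  qed
  have F0: "\<phi> \<zero>\<^bsub>I.F\<^esub> = \<zero>\<^bsub>D\<^esub>"
    using v_0 by (simp add: v_def I.cls_zero)
  have \<phi>_zero_iff: "\<phi> (I.cls n u) = \<zero>\<^bsub>D\<^esub> \<longleftrightarrow> u \<in> I.Q n" if "u \<in> I.P n" for n u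
  proof -
    have "\<zero>\<^bsub>I.F\<^esub> \<in> carrier I.F"
      using I.F_group by (intro abelian_monoid.zero_closed abelian_group.axioms(1))
    then show ?thesis
      using inj_on_eq_iff[OF inj I.cls_carrier[OF that], of "\<zero>\<^bsub>I.F\<^esub>"] I.cls_zero_iff[OF that] F0
      by simp
  qed
  define K where "K s = {u \<in> I.P i. Z s (v u)}" for s
  have K: "ideal (K s) R" if s: "s \<in> S" for s
  proof (rule idealI_add_mult)
    show "K s \<subseteq> carrier R" "\<zero> \<in> K s"
      using Nc(1,2) Z_zero[OF s] v_0 unfolding K_def by auto
    fix u assume u: "u \<in> K s"
    {
      fix w assume "w \<in> K s"
      then show "u \<oplus> w \<in> K s"
        using u Nc(3) v_add v_mem D.add[OF s] unfolding K_def by auto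
    }
    fix c assume c: "c \<in> carrier R"
    then show "c \<otimes> u \<in> K s"
      using u Nc(5) v_scalar v_mem D.smult[OF s scalar[OF c]] unfolding K_def by auto
  qed
  have "\<exists>x. x \<in> I.P i \<and> \<not> Z s (v x) \<and> (\<forall>t\<in>S - {s}. Z t (v x)) \<and>
      (\<forall>u\<in>I.P i. \<exists>c\<in>carrier R. Z s (v (u \<oplus> c \<otimes> x)))" if s: "s \<in> S" for s
  proof -
    obtain e where e: "e \<in> homog D i" "\<not> Z s e" "\<forall>t\<in>S - {s}. Z t e"
      "\<And>y. y \<in> homog D i \<Longrightarrow> \<exists>c\<in>scalars. Z s (y \<oplus>\<^bsub>D\<^esub> c \<odot>\<^bsub>D\<^esub> e)"
      using D.dual[OF s] by auto
    obtain x where x: "x \<in> I.P i" "e = v x"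
      using e(1) unfolding homog by auto
    have "\<exists>c\<in>carrier R. Z s (v (u \<oplus> c \<otimes> x))" if u: "u \<in> I.P i" for u
    proof -
      obtain c where c: "c \<in> carrier R" "Z s (v u \<oplus>\<^bsub>D\<^esub> cls 0 c \<odot>\<^bsub>D\<^esub> v x)"
        using e(4)[OF v_mem[OF u]] x(2) unfolding scalars_def by auto
      then show ?thesis
        using v_add[OF u Nc(5)[OF c(1) x(1)]] v_scalar[OF c(1) x(1)]
        by (intro bexI[of _ c]) simp_all
    qed
    then show ?thesis
      using e x by auto
  qed
  then obtain x where "\<forall>s\<in>S. x s \<in> I.P i \<and> \<not> Z s (v (x s)) \<and> (\<forall>t\<in>S - {s}. Z t (v (x s))) \<and>
      (\<forall>u\<in>I.P i. \<exists>c\<in>carrier R. Z s (v (u \<oplus> c \<otimes> x s)))"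
    using bchoice[of S "\<lambda>s x. x \<in> I.P i \<and> \<not> Z s (v x) \<and> (\<forall>t\<in>S - {s}. Z t (v x)) \<and>
      (\<forall>u\<in>I.P i. \<exists>c\<in>carrier R. Z s (v (u \<oplus> c \<otimes> x)))"] by blast
  then have x: "\<And>s. s \<in> S \<Longrightarrow> x s \<in> I.P i" "\<And>s. s \<in> S \<Longrightarrow> \<not> Z s (v (x s))"
    "\<And>s t. s \<in> S \<Longrightarrow> t \<in> S \<Longrightarrow> t \<noteq> s \<Longrightarrow> Z t (v (x s))"
    "\<And>s u. s \<in> S \<Longrightarrow> u \<in> I.P i \<Longrightarrow> \<exists>c\<in>carrier R. Z s (v (u \<oplus> c \<otimes> x s))"
    by simp_all
  interpret B: dual_basis R \<mm> "I.P i" S K x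
  proof (intro dual_basis.intro dual_basis_axioms.intro noetherian_local_ring_axioms)
    show "finite S" "ideal (I.P i) R"
      using D.finite I.P_ideal by auto
    fix s assume s: "s \<in> S"
    show "ideal (K s) R" "x s \<in> I.P i" "x s \<notin> K s"
      using K s x(1,2) unfolding K_def by auto
    show "x s \<in> K t" if "t \<in> S" "t \<noteq> s" for t
      using x(1,3) s that unfolding K_def by auto
    fix u assume u: "u \<in> I.P i"
    show "\<exists>c\<in>carrier R. u \<oplus> c \<otimes> x s \<in> K s"
      using x(4)[OF s u] Nc(3)[OF u] Nc(5) x(1)[OF s] unfolding K_def by auto
    show "c \<otimes> u \<in> K s" if c: "c \<in> \<mm>" for c
    proof -
      have "c \<otimes> u \<in> I.Q i"
        using c u by (rule ideal_prod.prod)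
      moreover have "c \<otimes> u \<in> I.P i"
        using calculation I.Q_subset by auto
      ultimately show ?thesis
        using \<phi>_zero_iff[of "c \<otimes> u" i] Z_zero[OF s] unfolding K_def v_def by simp
    qed
  qed
  have kernel: "B.common_kernel S = I.Q i"
  proof -
    have "B.common_kernel S = {u \<in> I.P i. \<forall>s\<in>S. Z s (v u)}"
      unfolding B.common_kernel_def K_def by auto
    also have "\<dots> = {u \<in> I.P i. u \<in> I.Q i}"
      using D.zero_iff[OF v_mem] \<phi>_zero_iff[of _ i] unfolding v_def by auto
    finally show ?thesis
      using I.Q_subset by auto
  qed
  then show "min_num_gens R (I.P i) = card S"
    by (rule B.min_num_gens_eq)
  have "B.common_kernel T = {u \<in> I.P i. \<forall>s\<in>T. Z s (v u)}"
    unfolding B.common_kernel_def K_def using D.subset by auto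
  \<comment> \<open>The coordinates in \<open>T\<close> detect whether \<open>a^l\<close> kills
    \<open>v u\<close> in \<open>D\<close>; by injectivity of \<open>\<phi>\<close> this happens
    exactly when the class of \<open>a^l u\<close> is zero in \<open>F(I)\<close>.\<close>
  also have "\<dots> = {u \<in> I.P i. u \<otimes> a [^] l \<in> I.Q (i + l)}"
  proof -
    have "(\<forall>s\<in>T. Z s (v u)) \<longleftrightarrow> u \<otimes> a [^] l \<in> I.Q (i + l)" if u: "u \<in> I.P i" for u
    proof -
      have mem: "a [^] l \<otimes> u \<in> I.P (l + i)"
        using I.mult_P[OF pow_mem[OF power_in_P'] u] .
      have "pow l \<odot>\<^bsub>D\<^esub> v u = \<zero>\<^bsub>D\<^esub> \<longleftrightarrow> a [^] l \<otimes> u \<in> I.Q (l + i)"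
        using \<phi>_zero_iff[OF mem] v_smult[OF power_in_P'[of l] u] by simp
      then show ?thesis
        using D.power_iff[OF v_mem[OF u]] a I.P_carrier[OF u] by (simp add: m_comm add.commute)
    qed
    then show ?thesis
      by blast
  qed
  also have "\<dots> = I.P i \<inter> colon R (I.Q (i + l)) (a [^] l)"
    using I.P_carrier unfolding colon_def by auto
  finally show "module_length R (subquotient R (I.P i \<inter> colon R (I.Q (i + l)) (a [^] l)) (I.Q i))
      = enat (card (S - T))"
    using B.module_length_common_kernel[OF D.subset] kernel by simp
qed

section \<open>Minimal numbers of generators and free exponents\<close>

text \<open>Iterating \<open>I^(n+1) = (a) I^n\<close> gives
  \<open>I^(n+m) \<subseteq> (a^m)\<close>. If \<open>a^k = 0\<close>, then
  \<open>I^(n+k) = 0\<close>, although it contains the power \<open>x^(n+k)\<close> of a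
  non-zero-divisor, which is nonzero.\<close>

lemma (in noetherian_local_ring) reduction_not_nilpotent:
  assumes I: "regular_ideal R I" and a: "a \<in> carrier R" and J: "reduction R (PIdl a) I"
  shows "a [^] (k::nat) \<noteq> \<zero>"
proof
  assume nil: "a [^] k = \<zero>"
  obtain n where n: "ideal_pow R I (Suc n) = (PIdl a) \<cdot> ideal_pow R I n"
    using J unfolding reduction_def by auto
  have I': "ideal I R"
    using I unfolding regular_ideal_def by auto
  have powers: "ideal_pow R I (n + m) \<subseteq> PIdl (a [^] m)" for m
  proof (induct m)
    case 0
    have "PIdl (a [^] (0::nat)) = carrier R"
      using cgenideal_eq_genideal[OF one_closed] genideal_one by simp
    then show ?case
      using ideal_closed(2)[OF ideal_pow_ideal[OF I']] by blast
  next
    case (Suc m)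
    have "ideal_pow R I (n + Suc m) = ideal_pow R I (Suc n + m)"
      by (simp only: add_Suc add_Suc_right)
    also have "\<dots> = ((PIdl a) \<cdot> ideal_pow R I n) \<cdot> ideal_pow R I m"
      unfolding ideal_pow_add[OF I'] n ..
    also have "\<dots> = (PIdl a) \<cdot> ideal_pow R I (n + m)"
      unfolding ideal_pow_add[OF I']
      by (intro ideal_prod_assoc cgenideal_ideal a ideal_pow_ideal I')
    also have "\<dots> \<subseteq> (PIdl a) \<cdot> (PIdl (a [^] m))"
      using Suc by (intro ideal_prod_mono order_refl)
    also have "\<dots> \<subseteq> PIdl (a [^] Suc m)"
    proof
      fix s assume "s \<in> (PIdl a) \<cdot> (PIdl (a [^] m))"
      then show "s \<in> PIdl (a [^] Suc m)"
      proof induct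
        case (prod u w)
        then have "u \<otimes> w \<in> (PIdl a) <#> (PIdl (a [^] m))"
          by (auto simp: set_mult_def)
        then show ?case
          using cgenideal_prod[of a "a [^] m"] a by (simp add: m_comm)
      next
        case (sum u w)
        then show ?case
          using ideal_closed(3)[OF cgenideal_ideal] a by simp
      qed
    qed
    finally show ?case .
  qed
  obtain x where x: "x \<in> I" "\<And>y. y \<in> carrier R \<Longrightarrow> x \<otimes> y = \<zero> \<Longrightarrow> y = \<zero>"
    using I unfolding regular_ideal_def by auto
  have xc: "x \<in> carrier R"
    using x(1) ideal_closed(2)[OF I'] by auto
  have "x [^] m \<in> ideal_pow R I m" for m :: nat
  proof (induct m)
    case 0
    show ?case
      unfolding ideal_pow_0 by simp
  next
    case (Suc m)
    then show ?case
      unfolding ideal_pow_Suc using x(1) by (simp add: ideal_prod.prod)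
  qed
  then have "x [^] (n + k) \<in> PIdl \<zero>"
    using powers[of k] nil by auto
  then have "x [^] (n + k) = \<zero>"
    by (auto simp: cgenideal_def)
  moreover have "x [^] m \<noteq> \<zero>" for m :: nat
  proof (induct m)
    case 0
    show ?case
      using one_notin_\<mm> ideal_closed(1)[OF \<mm>_ideal] by auto
  next
    case (Suc m)
    then show ?case
      using x(2)[of "x [^] m"] xc by (auto simp: m_comm)
  qed
  ultimately show False
    by blast
qed

lemma (in noetherian_local_ring) min_num_gens_power:
  assumes I: "regular_ideal R I" and a: "a \<in> carrier R" and J: "reduction R (PIdl a) I"
    and iso: "gmodule_iso (fiber_cone R \<mm> (PIdl a)) (fiber_gmodule R \<mm> I)
      (fiber_decomposition_module R \<mm> a r \<alpha> \<beta>)"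
    and i: "i \<le> r"
  shows "min_num_gens R (ideal_pow R I i) = (\<Sum>k\<le>i. \<alpha> k) + f_length R \<mm> I a r i (r - i)"
proof -
  interpret J: principal_fiber R \<mm> "PIdl a" a
    using reduction_not_nilpotent[OF I a J]
    by (intro principal_fiber.intro principal_fiber_axioms.intro fiber.intro fiber_axioms.intro
        noetherian_local_ring_axioms cgenideal_ideal a refl)
  let ?D = "fiber_decomposition_module R \<mm> a r \<alpha> \<beta>" and ?K = "SIGMA k:{1..r-1}. {1..r-k}"
  let ?free = "\<lambda>k. {..<\<alpha> k} \<times> (if k \<le> i then {()} else {})"
  \<comment> \<open>One coordinate for each copy of \<open>(F(J)/a^j F(J))(-k)\<close> that is
    nonzero in degree \<open>i\<close>.\<close>
  let ?tors = "\<lambda>(k, j). {..<\<beta> k j} \<times> (if k \<le> i \<and> i < k + j then {()} else {})"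
  let ?S = "Sigma {0..r} ?free" and ?S' = "Sigma ?K ?tors"
  have free: "coord_system J.scalars (J.pow (r - i))
      (gdirect_sum {0..r} (\<lambda>k. gcopies (gshift k (fiber_gmodule R \<mm> (PIdl a))) (\<alpha> k))) i ?S ?S
      (\<lambda>(k, s) x. (\<lambda>(n, t) x. x n = \<zero>\<^bsub>J.F\<^esub>) s (x k))"
  proof (rule coord_system_gdirect_sum)
    fix k
    show "coord_system J.scalars (J.pow (r - i))
        (gcopies (gshift k (fiber_gmodule R \<mm> (PIdl a))) (\<alpha> k)) i (?free k) (?free k)
        (\<lambda>(n, t) x. x n = \<zero>\<^bsub>J.F\<^esub>)"
      by (rule coord_system_gcopies) (rule J.coord_system_free)
  qed simp
  have "coord_system J.scalars (J.pow (r - i))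
      (gcopies (gshift k (fiber_quotient R \<mm> (PIdl a) (fiber_power_ideal R \<mm> a j))) (\<beta> k j)) i
      (?tors (k, j)) ({..<\<beta> k j} \<times> {}) (\<lambda>(n, t) x. x n = J.tail j)"
    if "(k, j) \<in> ?K" for k j
  proof -
    \<comment> \<open>This is where the range \<open>j \<le> r - k\<close> of the torsion exponents
      enters, with \<open>i \<le> r\<close> making \<open>r - i + i\<close> equal to
      \<open>r\<close>.\<close>
    have "j + k \<le> r - i + i"
      using that i by auto
    from coord_system_gcopies[OF J.coord_system_torsion[OF this]] show ?thesis
      unfolding prod.case .
  qed
  then have "coord_system J.scalars (J.pow (r - i))
      (gdirect_sum ?K (\<lambda>(k, j). gcopies (gshift k (fiber_quotient R \<mm> (PIdl a)
        (fiber_power_ideal R \<mm> a j))) (\<beta> k j))) i ?S' (SIGMA k:?K. {})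
      (\<lambda>(k, s) x. (\<lambda>(k, j) (n, t) x. x n = J.tail j) k s (x k))"
    by (intro coord_system_gdirect_sum) auto
  \<comment> \<open>Only the index sets matter from here on, so the coordinate functions are hidden
    behind \<open>Z\<close>.\<close>
  from coord_system_gdirect_sum2[OF free this]
  obtain Z where D: "coord_system J.scalars (J.pow (r - i)) ?D i (Sum_Type.Plus ?S ?S') (Sum_Type.Plus ?S {}) Z"
    unfolding fiber_decomposition_module_def by auto
  obtain \<phi> where \<phi>: "inj_on \<phi> (carrier (fiber_cone R \<mm> I))"
    "\<And>x y. x \<in> carrier (fiber_cone R \<mm> I) \<Longrightarrow> y \<in> carrier (fiber_cone R \<mm> I) \<Longrightarrow>
      \<phi> (x \<oplus>\<^bsub>fiber_cone R \<mm> I\<^esub> y) = \<phi> x \<oplus>\<^bsub>?D\<^esub> \<phi> y"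
    "\<And>c x. c \<in> carrier J.F \<Longrightarrow> x \<in> carrier (fiber_cone R \<mm> I) \<Longrightarrow>
      \<phi> (fiber_incl R \<mm> I c \<otimes>\<^bsub>fiber_cone R \<mm> I\<^esub> x) = c \<odot>\<^bsub>?D\<^esub> \<phi> x"
    "\<And>n. \<phi> ` fiber_degree R \<mm> I n = homog ?D n"
    using iso unfolding gmodule_iso_def bij_betw_def by (auto simp: fiber_gmodule_def Let_def)
  have "ideal I R" "PIdl a \<subseteq> I"
    using J I unfolding reduction_def regular_ideal_def by auto
  note inv = J.invariants_from_coordinates[OF this D \<phi>]
  have "card ?S = (\<Sum>k\<in>{0..r}. if k \<le> i then \<alpha> k else 0)"
    by (subst card_SigmaI) (auto intro!: sum.cong)
  also have "\<dots> = (\<Sum>k\<le>i. \<alpha> k)"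
    using i by (intro sum.mono_neutral_cong_right) auto
  finally have card: "card (Sum_Type.Plus ?S ?S') = (\<Sum>k\<le>i. \<alpha> k) + card ?S'"
    by (subst card_Plus) auto
  have "Sum_Type.Plus ?S ?S' - Sum_Type.Plus ?S {} = Inr ` ?S'"
    by auto
  then have card_diff: "card (Sum_Type.Plus ?S ?S' - Sum_Type.Plus ?S {}) = card ?S'"
    by (simp only: card_image inj_Inr)
  have "f_length R \<mm> I a r i (r - i) = card ?S'"
  proof (cases "i \<in> {1..r-1}")
    case True
    then have "f_length R \<mm> I a r i (r - i) = the_enat (enat (card (Sum_Type.Plus ?S ?S' - Sum_Type.Plus ?S {})))"
      by (simp only: f_length_def if_True inv(2)[symmetric])
    then show ?thesis
      by (simp only: card_diff the_enat.simps)
  next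
    case False
    \<comment> \<open>Here \<open>i\<close> is 0 or \<open>r\<close>. Torsion starts in degree 1 and
      ends below degree \<open>r\<close>, in agreement with the convention that \<open>f\<close> is
      0 outside \<open>{1..r-1}\<close>.\<close>
    then have empty: "?S' = {}"
      using i by (auto split: if_splits)
    show ?thesis
      using False by (simp only: f_length_def if_False empty card.empty)
  qed
  then show ?thesis
    using inv(1) card by simp
qed

theorem proposition2p7:
  fixes A :: "('a, 'b) ring_scheme" (structure)
    and \<mm> I :: "'a set" and a :: 'a and r i :: nat
    and \<alpha> :: "nat \<Rightarrow> nat" and \<beta> :: "nat \<Rightarrow> nat \<Rightarrow> nat"
  assumes "noetherian_local_ring A \<mm>"
    and "infinite (carrier (A Quot \<mm>))"
    and "regular_ideal A I"
    and "analytic_spread A \<mm> I = 1"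
    and "r = reduction_number A I"
    and "a \<in> carrier A"
    and "minimal_reduction A (PIdl a) I"
    and "gmodule_iso (fiber_cone A \<mm> (PIdl a)) (fiber_gmodule A \<mm> I)
           (fiber_decomposition_module A \<mm> a r \<alpha> \<beta>)"
    and "1 \<le> i" and "i \<le> r"
  shows "int (\<alpha> i) =
           int (min_num_gens A (ideal_pow A I i)) - int (min_num_gens A (ideal_pow A I (i - 1)))
           - (int (f_length A \<mm> I a r i (r - i)) - int (f_length A \<mm> I a r (i - 1) (r - (i - 1))))"
proof -
  have "reduction A (PIdl a) I"
    using assms(7) by (simp add: minimal_reduction_def)
  note gens = noetherian_local_ring.min_num_gens_power[OF assms(1,3,6) this assms(8)]
  \<comment> \<open>As \<open>1 \<le> i\<close>, the subtraction is not truncated and exactly the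
    summand \<open>\<alpha> i\<close> is split off.\<close>
  have "(\<Sum>k\<le>i. \<alpha> k) = (\<Sum>k\<le>i - 1. \<alpha> k) + \<alpha> i"
    using assms(9) by (cases i) auto
  then show ?thesis
    using gens[of i] gens[of "i - 1"] assms(9,10) by simp
qed

end
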